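(* Let $G$ be a graph with maximum degree $\Delta(G)\geq 8$ and maximum average degree ${\rm mad}(G)<\frac{14}{3}$. Then $\chi''_\Sigma(G)\leq \Delta(G)+3$.
   Context: Graphs are finite and simple. A proper total $k$-colouring of a graph $G=(V,E)$ is a map $c:V\cup E\to\{1,2,\ldots,k\}$ such that adjacent vertices receive distinct colours, adjacent edges (edges sharing an end-vertex) receive distinct colours, and every edge receives a colour distinct from the colours of both its end-vertices. For such $c$ and $w\in V$, let $s(w)=c(w)+\sum_{e\ni w}c(e)$, the sum over edges incident with $w$. A total neighbour sum distinguishing $k$-colouring (tnsd $k$-colouring) is a proper total $k$-colouring with $s(u)\neq s(v)$ for every edge $uv\in E$. The total neighbour sum distinguishing index $\chi''_\Sigma(G)$ is the least $k$ for which $G$ admits a tnsd $k$-colouring. The maximum average degree is ${\rm mad}(G)=\max\{2|E(H)|/|V(H)| : H\subseteq G\}$. *)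

theory Defs
  imports Complex_Main
begin

definition simple_graph :: "'a set \<Rightarrow> 'a set set \<Rightarrow> bool" where
  "simple_graph V E \<longleftrightarrow> finite V \<and> (\<forall>e\<in>E. e \<subseteq> V \<and> card e = 2)"

definition incident_edges :: "'a set set \<Rightarrow> 'a \<Rightarrow> 'a set set" where
  "incident_edges E v = {e \<in> E. v \<in> e}"

definition degree :: "'a set set \<Rightarrow> 'a \<Rightarrow> nat" where
  "degree E v = card (incident_edges E v)"

text \<open>Maximum degree (0 for the empty graph).\<close>
definition max_degree :: "'a set \<Rightarrow> 'a set set \<Rightarrow> nat" where
  "max_degree V E = Max (insert 0 (degree E ` V))"

definition mad :: "'a set \<Rightarrow> 'a set set \<Rightarrow> real" where
  "mad V E = Max (insert 0 {2 * real (card E') / real (card V') | V' E'.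
       V' \<subseteq> V \<and> V' \<noteq> {} \<and> E' \<subseteq> E \<and> (\<forall>e\<in>E'. e \<subseteq> V')})"

definition proper_total_colouring ::
  "'a set \<Rightarrow> 'a set set \<Rightarrow> nat \<Rightarrow> ('a \<Rightarrow> nat) \<Rightarrow> ('a set \<Rightarrow> nat) \<Rightarrow> bool" where
  "proper_total_colouring V E k f g \<longleftrightarrow>
     (\<forall>v\<in>V. f v \<in> {1..k}) \<and> (\<forall>e\<in>E. g e \<in> {1..k}) \<and>
     (\<forall>u\<in>V. \<forall>v\<in>V. {u, v} \<in> E \<longrightarrow> f u \<noteq> f v) \<and>
     (\<forall>e1\<in>E. \<forall>e2\<in>E. e1 \<noteq> e2 \<and> e1 \<inter> e2 \<noteq> {} \<longrightarrow> g e1 \<noteq> g e2) \<and>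
     (\<forall>e\<in>E. \<forall>v\<in>e. g e \<noteq> f v)"

definition colour_sum :: "'a set set \<Rightarrow> ('a \<Rightarrow> nat) \<Rightarrow> ('a set \<Rightarrow> nat) \<Rightarrow> 'a \<Rightarrow> nat" where
  "colour_sum E f g w = f w + (\<Sum>e\<in>incident_edges E w. g e)"

definition tnsd_colouring ::
  "'a set \<Rightarrow> 'a set set \<Rightarrow> nat \<Rightarrow> ('a \<Rightarrow> nat) \<Rightarrow> ('a set \<Rightarrow> nat) \<Rightarrow> bool" where
  "tnsd_colouring V E k f g \<longleftrightarrow> proper_total_colouring V E k f g \<and>
     (\<forall>u\<in>V. \<forall>v\<in>V. {u, v} \<in> E \<longrightarrow> colour_sum E f g u \<noteq> colour_sum E f g v)"

definition tnsd_index :: "'a set \<Rightarrow> 'a set set \<Rightarrow> nat" where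
  "tnsd_index V E = (LEAST k. \<exists>f g. tnsd_colouring V E k f g)"

end

theory Submission
  imports Defs "HOL-Library.FuncSet"
begin

text \<open>
  Let \<open>k = \<Delta> + 3\<close> and take a counterexample with fewest edges. A vertex of degree at most 3 can always
  be coloured last, since it has at most \<open>9 < k\<close> forbidden colours; so these small vertices stay
  uncoloured and impose no sum condition. Deleting a star of edges at a vertex \<open>v\<close>, colouring the
  rest and recolouring the star excludes a number of configurations. If all leaves of the star are
  small, the new edges need distinct representatives of their colour lists whose sum avoids the
  sums at the other neighbours of \<open>v\<close>, and \<open>n\<close> lists with \<open>e\<close> spare colours realise at least
  \<open>n e + 1\<close> different sums. If some leaves have degree 4, these are recoloured as well, and the
  Combinatorial Nullstellensatz is applied to a product of affine forms in at most five variables.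
  The leading coefficient that it needs does not depend on the constant terms, so it is nonzero as soon
  as some model instance, with other constant terms, has exactly one solution.

  The excluded configurations contradict \<open>mad < 14/3\<close>: after removing the vertices of degree at most 2,
  every vertex of degree 3 receives 5/9 and every vertex of degree 4 receives 1/6 from each neighbour,
  and then every vertex has charge at least 14/3.
\<close>

section \<open>Nullstellensatz for products of affine forms\<close>

definition node_weight :: "'a::field set \<Rightarrow> 'a \<Rightarrow> 'a" where
  "node_weight A a = inverse (\<Prod>b\<in>A - {a}. a - b)"

text \<open>Multiplying by \<open>x\<^sub>i - a\<close> removes \<open>a\<close> from the \<open>i\<close>-th side of the grid. On a product of
  \<open>\<Sum>\<^sub>i (|A\<^sub>i| - 1)\<close> affine forms the following functional reads off the coefficient of
  \<open>\<Prod>\<^sub>i x\<^sub>i^(|A\<^sub>i| - 1)\<close>, which depends neither on the constant terms nor on the grid itself.\<close>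

definition divided_difference :: "'i set \<Rightarrow> ('i \<Rightarrow> 'a::field set) \<Rightarrow> (('i \<Rightarrow> 'a) \<Rightarrow> 'a) \<Rightarrow> 'a" where
  "divided_difference I A F = (\<Sum>x\<in>Pi\<^sub>E I A. (\<Prod>i\<in>I. node_weight (A i) (x i)) * F x)"

lemma node_weight_nonzero:
  assumes "finite A"
  shows "node_weight A a \<noteq> 0"
  using assms by (auto simp: node_weight_def)

lemma node_weight_remove:
  assumes "finite A" "a \<in> A" "b \<noteq> a"
  shows "node_weight A b * (b - a) = node_weight (A - {a}) b"
proof -
  have "A - {b} = insert a (A - {a} - {b})" using assms by auto
  then have "(\<Prod>c\<in>A - {b}. b - c) = (b - a) * (\<Prod>c\<in>A - {a} - {b}. b - c)"
    using assms(1) by simp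
  then show ?thesis using assms(3) by (simp add: node_weight_def)
qed

lemma sum_node_weight:
  assumes "finite A" "A \<noteq> {}"
  shows "(\<Sum>a\<in>A. node_weight A a) = (if card A = 1 then 1 else 0)"
  using assms
proof (induction "card A" arbitrary: A rule: less_induct)
  case less
  show ?case
  proof (cases "card A = 1")
    case True
    then show ?thesis by (auto simp: card_1_singleton_iff node_weight_def)
  next
    case False
    then obtain a a' where a: "a \<in> A" "a' \<in> A" "a \<noteq> a'"
      using less.prems by (metis is_singletonI' is_singleton_altdef)
    have reduced: "(\<Sum>b\<in>A. node_weight A b * (b - c)) = (if card A = 2 then 1 else 0)" if c: "c \<in> {a, a'}" for c
    proof -
      have "(\<Sum>b\<in>A. node_weight A b * (b - c)) = (\<Sum>b\<in>A - {c}. node_weight A b * (b - c))"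
        using a c less.prems(1) by (subst sum.remove[of A c]) auto
      also have "\<dots> = (\<Sum>b\<in>A - {c}. node_weight (A - {c}) b)"
        using a c less.prems(1) by (intro sum.cong refl node_weight_remove) auto
      also have "\<dots> = (if card (A - {c}) = 1 then 1 else 0)"
        using a c less.prems(1) by (intro less.hyps) (auto intro: card_Diff1_less)
      also have "card (A - {c}) = 1 \<longleftrightarrow> card A = 2"
        using a c less.prems(1) by (auto simp: card_Diff_singleton)
      finally show ?thesis .
    qed
    have "(a' - a) * (\<Sum>b\<in>A. node_weight A b) =
      (\<Sum>b\<in>A. node_weight A b * (b - a)) - (\<Sum>b\<in>A. node_weight A b * (b - a'))"
      by (simp add: sum_distrib_left algebra_simps flip: sum_subtractf)
    also have "\<dots> = 0" using reduced by simp
    finally show ?thesis using a(3) False by simp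
  qed
qed

lemma divided_difference_empty: "i \<in> I \<Longrightarrow> A i = {} \<Longrightarrow> divided_difference I A F = 0"
  by (simp add: divided_difference_def PiE_eq_empty_iff)

lemma divided_difference_1:
  assumes "finite I" "\<And>i. i \<in> I \<Longrightarrow> finite (A i) \<and> A i \<noteq> {}"
  shows "divided_difference I A (\<lambda>_. 1) = (if \<forall>i\<in>I. card (A i) = 1 then 1 else 0)"
proof -
  have "divided_difference I A (\<lambda>_. 1) = (\<Prod>i\<in>I. \<Sum>a\<in>A i. node_weight (A i) a)"
    unfolding divided_difference_def using assms by (subst prod_sum_PiE) auto
  also have "\<dots> = (\<Prod>i\<in>I. if card (A i) = 1 then 1 else 0)"
    using assms(2) by (intro prod.cong refl) (simp add: sum_node_weight)
  also have "\<dots> = (if \<forall>i\<in>I. card (A i) = 1 then 1 else 0)"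
    using assms(1) by (auto intro: prod.neutral)
  finally show ?thesis .
qed

lemma divided_difference_mult_diff:
  assumes I: "finite I" "i \<in> I" and A: "\<And>j. j \<in> I \<Longrightarrow> finite (A j)" "a \<in> A i"
  shows "divided_difference I A (\<lambda>x. (x i - a) * F x) = divided_difference I (A(i := A i - {a})) F"
proof -
  let ?A = "A(i := A i - {a})"
  have weights: "(\<Prod>j\<in>I. node_weight (A j) (x j)) * (x i - a) = (\<Prod>j\<in>I. node_weight (?A j) (x j))"
    if x: "x \<in> Pi\<^sub>E I ?A" for x
  proof -
    have "x i \<noteq> a" using x I(2) by (auto simp: PiE_iff)
    moreover have "(\<Prod>j\<in>I - {i}. node_weight (A j) (x j)) = (\<Prod>j\<in>I - {i}. node_weight (?A j) (x j))"
      by (intro prod.cong) auto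
    ultimately show ?thesis
      using I node_weight_remove[OF A(1)[OF I(2)] A(2), of "x i"]
      by (simp add: prod.remove[of I i] mult_ac flip: mult.assoc)
  qed
  have sub: "Pi\<^sub>E I ?A \<subseteq> Pi\<^sub>E I A" by (rule PiE_mono) auto
  have "x i = a" if "x \<in> Pi\<^sub>E I A - Pi\<^sub>E I ?A" for x
    using that by (auto simp: PiE_iff split: if_splits)
  then show ?thesis
    unfolding divided_difference_def using weights sub I(1) A(1)
    by (intro sum.mono_neutral_cong_right finite_PiE) (auto simp: mult.assoc[symmetric])
qed

definition affine_form :: "'i set \<Rightarrow> ('i \<Rightarrow> 'a::comm_ring_1) \<Rightarrow> 'a \<Rightarrow> ('i \<Rightarrow> 'a) \<Rightarrow> 'a" where
  "affine_form I l c x = (\<Sum>i\<in>I. l i * x i) + c"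

lemma divided_difference_mult_affine:
  assumes "finite I" "\<And>i. i \<in> I \<Longrightarrow> finite (A i) \<and> a i \<in> A i"
  shows "divided_difference I A (\<lambda>x. affine_form I l c x * F x) =
    (\<Sum>i\<in>I. l i * divided_difference I (A(i := A i - {a i})) F) + affine_form I l c a * divided_difference I A F"
proof -
  let ?w = "\<lambda>x. \<Prod>i\<in>I. node_weight (A i) (x i)"
  have "affine_form I l c x * F x = (\<Sum>i\<in>I. l i * ((x i - a i) * F x)) + affine_form I l c a * F x" for x
    by (simp add: affine_form_def algebra_simps sum_subtractf sum_distrib_left)
  then have "divided_difference I A (\<lambda>x. affine_form I l c x * F x) =
    (\<Sum>x\<in>Pi\<^sub>E I A. \<Sum>i\<in>I. l i * (?w x * ((x i - a i) * F x))) + affine_form I l c a * divided_difference I A F"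
    by (simp add: divided_difference_def distrib_left sum.distrib sum_distrib_left mult.left_commute)
  also have "(\<Sum>x\<in>Pi\<^sub>E I A. \<Sum>i\<in>I. l i * (?w x * ((x i - a i) * F x))) =
    (\<Sum>i\<in>I. l i * divided_difference I A (\<lambda>x. (x i - a i) * F x))"
    by (subst sum.swap) (simp add: divided_difference_def sum_distrib_left)
  also have "\<dots> = (\<Sum>i\<in>I. l i * divided_difference I (A(i := A i - {a i})) F)"
    using assms by (intro sum.cong refl arg_cong[where f = "(*) _"] divided_difference_mult_diff) auto
  finally show ?thesis .
qed

definition grid_degree :: "'i set \<Rightarrow> ('i \<Rightarrow> 'a set) \<Rightarrow> nat" where
  "grid_degree I A = (\<Sum>i\<in>I. card (A i) - 1)"

lemma grid_degree_remove:
  assumes "finite I" "i \<in> I" "finite (A i)" "a \<in> A i" "A i \<noteq> {a}"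
  shows "Suc (grid_degree I (A(i := A i - {a}))) = grid_degree I A"
proof -
  have "A i - {a} \<noteq> {}" using assms(4,5) by blast
  then have "0 < card (A i - {a})" using assms(3) by (simp add: card_gt_0_iff)
  moreover have "(\<Sum>j\<in>I - {i}. card ((A(i := A i - {a})) j) - 1) = (\<Sum>j\<in>I - {i}. card (A j) - 1)"
    by (intro sum.cong) auto
  ultimately show ?thesis
    using assms(1-4) by (simp add: grid_degree_def sum.remove[of I i])
qed

lemma divided_difference_affine_prod_eq_0:
  assumes "finite I" "finite J" "\<And>i. i \<in> I \<Longrightarrow> finite (A i) \<and> A i \<noteq> {}" "card J < grid_degree I A"
  shows "divided_difference I A (\<lambda>x. \<Prod>j\<in>J. affine_form I (l j) (c j) x) = 0"
  using assms(2,3,4)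
proof (induction J arbitrary: A rule: finite_induct)
  case empty
  then have "(\<Sum>i\<in>I. card (A i) - 1) \<noteq> 0" by (simp add: grid_degree_def)
  then have "\<not> (\<forall>i\<in>I. card (A i) = 1)" by (rule contrapos_nn) simp
  then show ?case using divided_difference_1[of I A] assms(1) empty by auto
next
  case (insert j J)
  let ?F = "\<lambda>x. \<Prod>j\<in>J. affine_form I (l j) (c j) x"
  have "\<forall>i\<in>I. \<exists>a. a \<in> A i" using insert.prems(1) by blast
  then obtain a where a: "\<And>i. i \<in> I \<Longrightarrow> a i \<in> A i" by metis
  have removed: "divided_difference I (A(i := A i - {a i})) ?F = 0" if i: "i \<in> I" for i
  proof (cases "A i = {a i}")
    case True
    then show ?thesis using i by (simp add: divided_difference_empty)
  next
    case False
    show ?thesis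
    proof (rule insert.IH)
      show "card J < grid_degree I (A(i := A i - {a i}))"
        using grid_degree_remove[of I i A "a i"] assms(1) insert.prems insert.hyps i a False by simp
    qed (use insert.prems(1) a i False in \<open>auto split: if_splits\<close>)
  qed
  have "divided_difference I A ?F = 0"
    using insert.prems insert.hyps by (intro insert.IH) auto
  then show ?case
    using divided_difference_mult_affine[of I A a "l j" "c j" ?F] assms(1) insert.prems(1) insert.hyps a removed by simp
qed

lemma divided_difference_affine_prod_cong:
  assumes "finite I" "finite J" "\<And>i. i \<in> I \<Longrightarrow> finite (A i) \<and> A i \<noteq> {}" "card J = grid_degree I A"
    and "\<And>i. i \<in> I \<Longrightarrow> finite (B i) \<and> card (B i) = card (A i)"
  shows "divided_difference I A (\<lambda>x. \<Prod>j\<in>J. affine_form I (l j) (c j) x) =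
    divided_difference I B (\<lambda>x. \<Prod>j\<in>J. affine_form I (l j) (d j) x)"
  using assms(2,3,4,5)
proof (induction J arbitrary: A B rule: finite_induct)
  case empty
  have B: "finite (B i) \<and> B i \<noteq> {}" if "i \<in> I" for i
    using empty that by fastforce
  show ?case using divided_difference_1[of I A] divided_difference_1[of I B] B empty assms(1) by simp
next
  case (insert j J)
  let ?F = "\<lambda>x. \<Prod>j\<in>J. affine_form I (l j) (c j) x" and ?G = "\<lambda>x. \<Prod>j\<in>J. affine_form I (l j) (d j) x"
  have B: "finite (B i) \<and> B i \<noteq> {}" if "i \<in> I" for i
    using insert.prems that by fastforce
  have "\<forall>i\<in>I. \<exists>a. a \<in> A i" "\<forall>i\<in>I. \<exists>b. b \<in> B i" using insert.prems(1) B by blast+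
  then obtain a b where a: "\<And>i. i \<in> I \<Longrightarrow> a i \<in> A i" and b: "\<And>i. i \<in> I \<Longrightarrow> b i \<in> B i" by metis
  have removed: "divided_difference I (A(i := A i - {a i})) ?F = divided_difference I (B(i := B i - {b i})) ?G"
    if i: "i \<in> I" for i
  proof (cases "A i = {a i}")
    case True
    then have "B i = {b i}" using insert.prems(3)[OF i] b[OF i] by (auto simp: card_1_singleton_iff)
    with True show ?thesis using i by (simp add: divided_difference_empty)
  next
    case False
    show ?thesis
    proof (rule insert.IH)
      show "card J = grid_degree I (A(i := A i - {a i}))"
        using grid_degree_remove[of I i A "a i"] assms(1) insert.prems insert.hyps i a False by simp
    qed (use insert.prems(1,3) a b i False in \<open>auto split: if_splits simp: card_Diff_singleton\<close>)
  qed
  have deg: "grid_degree I B = grid_degree I A" using insert.prems(3) by (simp add: grid_degree_def)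
  have "divided_difference I A ?F = 0" "divided_difference I B ?G = 0"
    using insert.prems insert.hyps B deg assms(1) by (auto intro!: divided_difference_affine_prod_eq_0)
  then show ?case
    using divided_difference_mult_affine[of I A a "l j" "c j" ?F]
      divided_difference_mult_affine[of I B b "l j" "d j" ?G] assms(1) insert.prems(1) insert.hyps B a b removed by simp
qed

text \<open>The model instance with grid \<open>A\<close> and constant terms \<open>c\<close> certifies that the coefficient is nonzero.\<close>

theorem affine_nullstellensatz:
  fixes l :: "'j \<Rightarrow> 'i \<Rightarrow> 'a::field"
  assumes "finite I" "finite J" "\<And>i. i \<in> I \<Longrightarrow> finite (A i)" "card J = grid_degree I A"
    and unique: "x \<in> Pi\<^sub>E I A" "\<And>z. z \<in> Pi\<^sub>E I A \<Longrightarrow> (\<forall>j\<in>J. affine_form I (l j) (c j) z \<noteq> 0) \<longleftrightarrow> z = x"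
    and larger: "\<And>i. i \<in> I \<Longrightarrow> card (A i) \<le> card (B i)"
  obtains y where "y \<in> Pi\<^sub>E I B" "\<And>j. j \<in> J \<Longrightarrow> affine_form I (l j) (d j) y \<noteq> 0"
proof -
  let ?F = "\<lambda>x. \<Prod>j\<in>J. affine_form I (l j) (c j) x" and ?G = "\<lambda>x. \<Prod>j\<in>J. affine_form I (l j) (d j) x"
  have F: "?F z \<noteq> 0 \<longleftrightarrow> z = x" if "z \<in> Pi\<^sub>E I A" for z
    using unique(2)[OF that] assms(2) by (simp add: prod_zero_iff)
  have A: "finite (A i) \<and> A i \<noteq> {}" if "i \<in> I" for i using assms(3) unique(1) that by auto
  have "\<exists>C \<subseteq> B i. card C = card (A i) \<and> finite C" if "i \<in> I" for i
    using larger[OF that] A[OF that] by (metis card_gt_0_iff card.infinite obtain_subset_with_card_n)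
  then obtain C where C: "\<And>i. i \<in> I \<Longrightarrow> C i \<subseteq> B i \<and> card (C i) = card (A i) \<and> finite (C i)" by metis
  have "divided_difference I A ?F = (\<Prod>i\<in>I. node_weight (A i) (x i)) * ?F x"
    unfolding divided_difference_def using unique(1) F assms(1) A
    by (subst sum.remove[of _ x]) (auto intro!: finite_PiE sum.neutral)
  then have "divided_difference I A ?F \<noteq> 0" using F unique(1) A assms(1) by (simp add: node_weight_nonzero)
  moreover have "divided_difference I A ?F = divided_difference I C ?G"
    using assms(1,2,4) A C by (intro divided_difference_affine_prod_cong) auto
  ultimately obtain y where "y \<in> Pi\<^sub>E I C" "?G y \<noteq> 0"
    unfolding divided_difference_def by (metis (no_types, lifting) mult_eq_0_iff sum.neutral)
  then show thesis using that[of y] C assms(2) by (auto simp: PiE_iff prod_zero_iff)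
qed

definition dot :: "int list \<Rightarrow> int list \<Rightarrow> int" where
  "dot l x = (\<Sum>(a, b)\<leftarrow>zip l x. a * b)"

definition rat_point :: "int list \<Rightarrow> nat \<Rightarrow> rat" where
  "rat_point x = (\<lambda>i\<in>{..<length x}. of_int (x ! i))"

lemma rat_point_inject:
  assumes "length x = length y"
  shows "rat_point x = rat_point y \<longleftrightarrow> x = y"
proof
  assume eq: "rat_point x = rat_point y"
  show "x = y"
  proof (rule nth_equalityI[OF assms])
    fix i assume "i < length x"
    then show "x ! i = y ! i" using fun_cong[OF eq, of i] assms by (simp add: rat_point_def)
  qed
qed simp

lemma affine_form_rat_point:
  assumes "length l = length x"
  shows "affine_form {..<length x} (\<lambda>i. of_int (l ! i)) (- of_int c) (rat_point x) = of_int (dot l x - c)"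
proof -
  have "dot l x = (\<Sum>i<length x. l ! i * x ! i)"
    using assms by (simp add: dot_def sum_list_sum_nth case_prod_beta atLeast0LessThan)
  then show ?thesis by (simp add: affine_form_def rat_point_def)
qed

lemma PiE_rat_point:
  "Pi\<^sub>E {..<length As} (\<lambda>i. of_int ` (As ! i)) = rat_point ` {x. list_all2 (\<in>) x As}"
proof (intro set_eqI iffI)
  fix x :: "nat \<Rightarrow> rat" assume x: "x \<in> Pi\<^sub>E {..<length As} (\<lambda>i. of_int ` (As ! i))"
  then have "\<forall>i<length As. \<exists>a. a \<in> As ! i \<and> x i = of_int a" by (auto simp: PiE_iff)
  then obtain z where z: "length z = length As" "\<And>i. i < length As \<Longrightarrow> z ! i \<in> As ! i \<and> x i = of_int (z ! i)"
    unfolding Skolem_list_nth by auto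
  then have "x = rat_point z" using x by (auto simp: rat_point_def PiE_iff extensional_def)
  then show "x \<in> rat_point ` {x. list_all2 (\<in>) x As}" using z by (auto simp: list_all2_conv_all_nth)
qed (clarsimp simp: rat_point_def list_all2_conv_all_nth)

text \<open>Fixing the variables one by one turns the exhaustive search of a grid into a backtracking search that
  is short enough for the simplifier: a branch ends as soon as some form has become constant with the
  forbidden value.\<close>

fun survivors :: "(int list \<times> int) list \<Rightarrow> int list list \<Rightarrow> int list list" where
  "survivors fs [] = (if list_all (\<lambda>(l, c). c \<noteq> 0) fs then [[]] else [])"
| "survivors fs (A # As) = (if list_ex (\<lambda>(l, c). c = 0 \<and> list_all ((=) 0) l) fs then []
     else concat (map (\<lambda>a. map ((#) a) (survivors (map (\<lambda>(l, c). (tl l, c - hd l * a)) fs) As)) A))"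

lemma dot_zero: "list_all ((=) 0) l \<Longrightarrow> dot l x = 0"
proof (induction l arbitrary: x)
  case (Cons a l)
  then show ?case by (cases x) (auto simp: dot_def)
qed (simp add: dot_def)

lemma set_survivors:
  assumes "\<forall>(l, c)\<in>set fs. length l = length As"
  shows "set (survivors fs As) = {x \<in> set (product_lists As). \<forall>(l, c)\<in>set fs. dot l x \<noteq> c}"
  using assms
proof (induction As arbitrary: fs)
  case Nil
  then show ?case by (auto simp: list_all_iff dot_def)
next
  case (Cons A As)
  let ?fs = "\<lambda>a. map (\<lambda>(l, c). (tl l, c - hd l * a)) fs"
  have dot_Cons: "dot l (a # x) = hd l * a + dot (tl l) x" if "(l, c) \<in> set fs" for l c a x
    using that Cons.prems by (cases l) (auto simp: dot_def)
  have "set (survivors (?fs a) As) = {x \<in> set (product_lists As). \<forall>(l, c)\<in>set (?fs a). dot l x \<noteq> c}" for a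
    using Cons.prems by (intro Cons.IH) auto
  moreover have "(\<forall>(l, c)\<in>set (?fs a). dot l x \<noteq> c) \<longleftrightarrow> (\<forall>(l, c)\<in>set fs. dot l (a # x) \<noteq> c)" for a x
    using dot_Cons by (fastforce simp: algebra_simps)
  ultimately have survivors_Cons: "set (survivors (?fs a) As) =
      {x \<in> set (product_lists As). \<forall>(l, c)\<in>set fs. dot l (a # x) \<noteq> c}" for a
    by presburger
  show ?case
  proof (cases "list_ex (\<lambda>(l, c). c = 0 \<and> list_all ((=) 0) l) fs")
    case True
    then obtain l where "(l, 0) \<in> set fs" "\<And>x. dot l x = 0" by (auto simp: list_ex_iff dot_zero)
    then have "\<not> (\<forall>(l, c)\<in>set fs. dot l x \<noteq> c)" for x by blast
    with True show ?thesis by simp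
  next
    case False
    then show ?thesis using survivors_Cons by auto
  qed
qed

lemma affine_forms_nonzero_iff:
  assumes "\<forall>l\<in>set ls. length l = length z" "length es = length ls"
  shows "(\<forall>j\<in>{..<length ls}. affine_form {..<length z} (\<lambda>i. of_int (ls ! j ! i)) (- of_int (es ! j)) (rat_point z) \<noteq> 0)
    \<longleftrightarrow> list_all2 (\<lambda>l e. dot l z \<noteq> e) ls es"
  using assms affine_form_rat_point[of _ z]
  by (simp add: list_all2_conv_all_nth Ball_def del: of_int_diff)

lemma unique_survivor:
  assumes "survivors (zip ls cs) As = [x]" "\<forall>l\<in>set ls. length l = length As" "length cs = length ls"
  shows "{z \<in> set (product_lists As). list_all2 (\<lambda>l c. dot l z \<noteq> c) ls cs} = {x}"
  using set_survivors[of "zip ls cs" As] assms by (auto simp: list_all2_iff dest: set_zip_leftD)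

corollary affine_nullstellensatz_list:
  assumes model: "survivors (zip ls cs) As = [x]"
    and grid: "\<forall>A\<in>set As. distinct A" "length ls = (\<Sum>A\<leftarrow>As. length A - 1)"
    and lengths: "\<forall>l\<in>set ls. length l = length As" "length cs = length ls" "length ds = length ls"
    and larger: "list_all2 (\<lambda>A B. length A \<le> card B) As Bs"
  obtains y where "list_all2 (\<in>) y Bs" "list_all2 (\<lambda>l d. dot l y \<noteq> d) ls ds"
proof -
  let ?I = "{..<length As}" and ?J = "{..<length ls}"
  let ?l = "\<lambda>j i. of_int (ls ! j ! i) :: rat"
  let ?A = "\<lambda>i. of_int ` (map set As ! i) :: rat set" and ?B = "\<lambda>i. of_int ` (Bs ! i) :: rat set"
  have length_Bs: "length Bs = length As" using larger by (simp add: list_all2_lengthD)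
  have card_A: "card (?A i) = length (As ! i)" if "i < length As" for i
    using grid(1) that by (simp add: card_image inj_on_def distinct_card)
  have PiE_A: "Pi\<^sub>E ?I ?A = rat_point ` set (product_lists As)"
    using PiE_rat_point[of "map set As"] by (simp add: product_lists_set list_all2_map2)
  have unique: "{z \<in> set (product_lists As). list_all2 (\<lambda>l c. dot l z \<noteq> c) ls cs} = {x}"
    using model lengths(1,2) by (rule unique_survivor)
  then have x: "x \<in> set (product_lists As)" by blast
  have length_point: "length z = length As" if "z \<in> set (product_lists As)" for z
    using that by (auto simp: product_lists_set dest: list_all2_lengthD)
  show thesis
  proof (rule affine_nullstellensatz[of ?I ?J ?A "rat_point x" ?l "\<lambda>j. - of_int (cs ! j)" ?B "\<lambda>j. - of_int (ds ! j)"])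
    show "card ?J = grid_degree ?I ?A"
      using grid(2) card_A by (simp add: grid_degree_def sum_list_sum_nth atLeast0LessThan)
    show "rat_point x \<in> Pi\<^sub>E ?I ?A" unfolding PiE_A using x by (rule imageI)
    show "(\<forall>j\<in>?J. affine_form ?I (?l j) (- of_int (cs ! j)) z \<noteq> 0) \<longleftrightarrow> z = rat_point x"
      if z: "z \<in> Pi\<^sub>E ?I ?A" for z
    proof -
      obtain w where w: "w \<in> set (product_lists As)" "z = rat_point w" using z PiE_A by auto
      then have "list_all2 (\<lambda>l c. dot l w \<noteq> c) ls cs \<longleftrightarrow> w = x" using unique by blast
      then show ?thesis
        using affine_forms_nonzero_iff[of ls w cs] lengths(1,2) length_point w x by (simp add: rat_point_inject)
    qed
    show "card (?A i) \<le> card (?B i)" if "i \<in> ?I" for i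
      using that larger card_A[of i] by (simp add: list_all2_conv_all_nth card_image inj_on_def)
  next
    fix y assume "y \<in> Pi\<^sub>E ?I ?B" and y: "\<And>j. j \<in> ?J \<Longrightarrow> affine_form ?I (?l j) (- of_int (ds ! j)) y \<noteq> 0"
    then obtain z where z: "y = rat_point z" "list_all2 (\<in>) z Bs" using PiE_rat_point[of Bs] length_Bs by auto
    then have "length z = length As" using length_Bs by (simp add: list_all2_lengthD)
    then show thesis using that[of z] z y affine_forms_nonzero_iff[of ls z ds] lengths(1,3) by simp
  qed auto
qed

section \<open>Recolouring at vertices of degree 4\<close>

lemma subset_list_of_card_le:
  assumes "finite S" "card S \<le> n"
  shows "\<exists>l. length l = n \<and> S \<subseteq> set l"
proof -
  obtain l where l: "set l = S" "length l = card S" using finite_distinct_list[OF assms(1)] distinct_card by metis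
  show ?thesis using assms(2) l by (intro exI[of _ "l @ replicate (n - card S) undefined"]) auto
qed

lemma subset_of_card_le_3:
  assumes "finite S" "card S \<le> 3"
  obtains a b c where "S \<subseteq> {a, b, c}"
proof -
  obtain l where "length l = 3" "S \<subseteq> set l" using subset_list_of_card_le[OF assms] by blast
  then show thesis using that by (auto simp: numeral_eq_Suc length_Suc_conv)
qed

lemma subset_of_card_le_4:
  assumes "finite S" "card S \<le> 4"
  obtains a b c d where "S \<subseteq> {a, b, c, d}"
proof -
  obtain l where "length l = 4" "S \<subseteq> set l" using subset_list_of_card_le[OF assms] by blast
  then show thesis using that by (auto simp: numeral_eq_Suc length_Suc_conv)
qed

text \<open>In this section \<open>?cs\<close> and \<open>?As\<close> are the constants and the grid of a model instance with a unique
  solution, found by computer search, and \<open>?ds\<close> are the constants of the given instance. The sums \<open>su\<close>, \<open>st\<close>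
  and \<open>sv\<close> of fixed colours belong to one or two vertices of degree 4 and to their common neighbour, which
  receives colour \<open>y\<close>; \<open>a\<close> and \<open>b\<close> are the colours of the edges between them.\<close>

lemma choose_edge_and_ends:
  fixes A Y F :: "nat set"
  assumes "5 \<le> card A" "5 \<le> card Y" "3 \<le> card F"
    and "finite U" "card U \<le> 3" "finite W" "card W \<le> 3"
  obtains a y f where "a \<in> A" "y \<in> Y" "f \<in> F"
    "a \<noteq> y" "a \<noteq> f" "y \<noteq> f" "su + a + f \<notin> U"
    "sv + a + y \<notin> W" "sv + y \<noteq> su + f"
proof -
  obtain u1 u2 u3 where U: "U \<subseteq> {u1, u2, u3}" using subset_of_card_le_3 assms by metis
  obtain w1 w2 w3 where W: "W \<subseteq> {w1, w2, w3}" using subset_of_card_le_3 assms by metis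
  let ?ls = "[[1,-1,0], [1,0,-1], [0,1,-1], [0,1,-1], [1,0,1], [1,0,1], [1,0,1], [1,1,0], [1,1,0], [1,1,0]]"
  let ?cs = "[-1, 1, 6, 5, 2, 3, 4, 5, 7, 3]"
  let ?ds = "[0, 0, 0, int su - int sv, int u1 - int su, int u2 - int su, int u3 - int su, int w1 - int sv,
    int w2 - int sv, int w3 - int sv]"
  let ?As = "[[0,1,2,3,4], [1,3,5,6,7], [0,1,2]]"
  have model: "survivors (zip ?ls ?cs) ?As = [[4, 6, 2]]" by code_simp
  obtain p where p: "list_all2 (\<in>) p [int ` A, int ` Y, int ` F]" "list_all2 (\<lambda>l d. dot l p \<noteq> d) ?ls ?ds"
    by (rule affine_nullstellensatz_list[OF model, of ?ds "[int ` A, int ` Y, int ` F]"])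
      (use assms(1-3) in \<open>simp_all add: card_image\<close>)
  then obtain a y f where coords: "p = [int a, int y, int f]" "a \<in> A" "y \<in> Y" "f \<in> F"
    by (auto simp: list_all2_Cons2)
  have "a \<noteq> y \<and> a \<noteq> f \<and> y \<noteq> f \<and> su + a + f \<notin> {u1, u2, u3} \<and>
    sv + a + y \<notin> {w1, w2, w3} \<and> sv + y \<noteq> su + f"
    using p(2) unfolding coords(1)
    by (simp add: dot_def add_diff_eq eq_diff_eq diff_eq_eq add_ac flip: of_nat_add)
  then show thesis using that[of a y f] coords U W by blast
qed

lemma choose_small_edge_edge_and_ends:
  fixes X A Y F :: "nat set"
  assumes "5 \<le> card X" "4 \<le> card A" "3 \<le> card Y" "5 \<le> card F"
    and "finite U" "card U \<le> 3" "finite W" "card W \<le> 4"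
  obtains x a y f where "x \<in> X" "a \<in> A" "y \<in> Y" "f \<in> F"
    "x \<noteq> a" "x \<noteq> y" "a \<noteq> y" "a \<noteq> f" "y \<noteq> f"
    "su + a + f \<notin> U" "sv + x + a + y \<notin> W" "sv + x + y \<noteq> su + f"
proof -
  obtain u1 u2 u3 where U: "U \<subseteq> {u1, u2, u3}" using subset_of_card_le_3 assms by metis
  obtain w1 w2 w3 w4 where W: "W \<subseteq> {w1, w2, w3, w4}" using subset_of_card_le_4 assms by metis
  let ?ls = "[[1,-1,0,0], [1,0,-1,0], [0,1,-1,0], [0,1,0,-1], [0,0,1,-1], [0,1,0,1], [0,1,0,1], [0,1,0,1],
    [1,0,1,-1], [1,1,1,0], [1,1,1,0], [1,1,1,0], [1,1,1,0]]"
  let ?cs = "[-1, 0, 1, 1, -1, 6, 2, 5, 1, 7, 4, 8, 6]"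
  let ?ds = "[0, 0, 0, 0, 0, int u1 - int su, int u2 - int su, int u3 - int su, int su - int sv,
    int w1 - int sv, int w2 - int sv, int w3 - int sv, int w4 - int sv]"
  let ?As = "[[0,1,2,3,4], [1,2,3,5], [0,1,2], [0,1,2,3,4]]"
  have model: "survivors (zip ?ls ?cs) ?As = [[3, 5, 2, 2]]" by code_simp
  obtain p where p: "list_all2 (\<in>) p [int ` X, int ` A, int ` Y, int ` F]" "list_all2 (\<lambda>l d. dot l p \<noteq> d) ?ls ?ds"
    by (rule affine_nullstellensatz_list[OF model, of ?ds "[int ` X, int ` A, int ` Y, int ` F]"])
      (use assms(1-4) in \<open>simp_all add: card_image\<close>)
  then obtain x a y f where coords: "p = [int x, int a, int y, int f]" "x \<in> X" "a \<in> A" "y \<in> Y" "f \<in> F"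
    by (auto simp: list_all2_Cons2)
  have "x \<noteq> a \<and> x \<noteq> y \<and> a \<noteq> y \<and> a \<noteq> f \<and> y \<noteq> f \<and>
    su + a + f \<notin> {u1, u2, u3} \<and> sv + x + a + y \<notin> {w1, w2, w3, w4} \<and>
    sv + x + y \<noteq> su + f"
    using p(2) unfolding coords(1)
    by (simp add: dot_def add_diff_eq eq_diff_eq diff_eq_eq add_ac flip: of_nat_add)
  then show thesis using that[of x a y f] coords U W by blast
qed

lemma choose_two_small_edges_edge_and_end:
  fixes X Z A F :: "nat set"
  assumes "5 \<le> card X" "4 \<le> card Z" "3 \<le> card A" "4 \<le> card F"
    and "finite U" "card U \<le> 3" "finite W" "card W \<le> 4"
  obtains x z a f where "x \<in> X" "z \<in> Z" "a \<in> A" "f \<in> F"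
    "x \<noteq> z" "x \<noteq> a" "z \<noteq> a" "a \<noteq> f" "su + a + f \<notin> U"
    "sv + x + z + a \<notin> W" "sv + x + z \<noteq> su + f"
proof -
  obtain u1 u2 u3 where U: "U \<subseteq> {u1, u2, u3}" using subset_of_card_le_3 assms by metis
  obtain w1 w2 w3 w4 where W: "W \<subseteq> {w1, w2, w3, w4}" using subset_of_card_le_4 assms by metis
  let ?ls = "[[1,-1,0,0], [1,0,-1,0], [0,1,-1,0], [0,0,1,-1], [0,0,1,1], [0,0,1,1], [0,0,1,1], [1,1,0,-1],
    [1,1,1,0], [1,1,1,0], [1,1,1,0], [1,1,1,0]]"
  let ?cs = "[-2, 2, 4, -1, 2, 3, 4, 3, 5, 7, 6, 9]"
  let ?ds = "[0, 0, 0, 0, int u1 - int su, int u2 - int su, int u3 - int su, int su - int sv,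
    int w1 - int sv, int w2 - int sv, int w3 - int sv, int w4 - int sv]"
  let ?As = "[[0,1,2,3,4], [2,3,4,5], [0,1,2], [0,1,2,3]]"
  have model: "survivors (zip ?ls ?cs) ?As = [[4, 3, 1, 0]]" by code_simp
  obtain p where p: "list_all2 (\<in>) p [int ` X, int ` Z, int ` A, int ` F]" "list_all2 (\<lambda>l d. dot l p \<noteq> d) ?ls ?ds"
    by (rule affine_nullstellensatz_list[OF model, of ?ds "[int ` X, int ` Z, int ` A, int ` F]"])
      (use assms(1-4) in \<open>simp_all add: card_image\<close>)
  then obtain x z a f where coords: "p = [int x, int z, int a, int f]" "x \<in> X" "z \<in> Z" "a \<in> A" "f \<in> F"
    by (auto simp: list_all2_Cons2)
  have "x \<noteq> z \<and> x \<noteq> a \<and> z \<noteq> a \<and> a \<noteq> f \<and>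
    su + a + f \<notin> {u1, u2, u3} \<and> sv + x + z + a \<notin> {w1, w2, w3, w4} \<and>
    sv + x + z \<noteq> su + f"
    using p(2) unfolding coords(1)
    by (simp add: dot_def add_diff_eq eq_diff_eq diff_eq_eq add_ac flip: of_nat_add)
  then show thesis using that[of x z a f] coords U W by blast
qed

lemma choose_two_edges_and_three_ends:
  fixes A F Y B G :: "nat set"
  assumes "5 \<le> card A" "3 \<le> card F" "5 \<le> card Y" "5 \<le> card B" "5 \<le> card G"
    and "finite U" "card U \<le> 3" "finite T" "card T \<le> 3" "finite W" "card W \<le> 3"
  obtains a f y b g where "a \<in> A" "f \<in> F" "y \<in> Y" "b \<in> B" "g \<in> G"
    "a \<noteq> b" "a \<noteq> y" "b \<noteq> y" "a \<noteq> f" "b \<noteq> g" "y \<noteq> f"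
    "y \<noteq> g" "su + a + f \<notin> U" "st + b + g \<notin> T" "sv + a + b + y \<notin> W"
    "sv + b + y \<noteq> su + f" "sv + a + y \<noteq> st + g"
proof -
  obtain u1 u2 u3 where U: "U \<subseteq> {u1, u2, u3}" using subset_of_card_le_3 assms by metis
  obtain t1 t2 t3 where T: "T \<subseteq> {t1, t2, t3}" using subset_of_card_le_3 assms by metis
  obtain w1 w2 w3 where W: "W \<subseteq> {w1, w2, w3}" using subset_of_card_le_3 assms by metis
  let ?ls = "[[1,-1,0,0,0], [0,-1,1,0,0], [1,1,0,0,0], [1,1,0,0,0], [1,1,0,0,0], [0,-1,1,1,0], [0,0,0,1,-1],
    [0,0,1,0,-1], [0,0,0,1,1], [0,0,0,1,1], [0,0,0,1,1], [1,0,1,0,-1], [1,0,0,-1,0], [1,0,-1,0,0],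
    [0,0,-1,1,0], [1,0,1,1,0], [1,0,1,1,0], [1,0,1,1,0]]"
  let ?cs = "[0, 0, 3, 4, 5, 4, 3, 1, 10, 9, 8, -1, -2, 0, 2, 8, 7, 9]"
  let ?ds = "[0, 0, int u1 - int su, int u2 - int su, int u3 - int su, int su - int sv, 0, 0,
    int t1 - int st, int t2 - int st, int t3 - int st, int st - int sv, 0, 0, 0, int w1 - int sv,
    int w2 - int sv, int w3 - int sv]"
  let ?As = "[[0,1,2,3,4], [1,2,3], [0,1,2,3,4], [2,3,4,5,6], [0,2,4,5,6]]"
  have model: "survivors (zip ?ls ?cs) ?As = [[4, 2, 3, 4, 0]]" by code_simp
  obtain p where p: "list_all2 (\<in>) p [int ` A, int ` F, int ` Y, int ` B, int ` G]" "list_all2 (\<lambda>l d. dot l p \<noteq> d) ?ls ?ds"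
    by (rule affine_nullstellensatz_list[OF model, of ?ds "[int ` A, int ` F, int ` Y, int ` B, int ` G]"])
      (use assms(1-5) in \<open>simp_all add: card_image\<close>)
  then obtain a f y b g where coords: "p = [int a, int f, int y, int b, int g]" "a \<in> A" "f \<in> F" "y \<in> Y" "b \<in> B" "g \<in> G"
    by (auto simp: list_all2_Cons2)
  have "a \<noteq> b \<and> a \<noteq> y \<and> b \<noteq> y \<and> a \<noteq> f \<and> b \<noteq> g \<and>
    y \<noteq> f \<and> y \<noteq> g \<and> su + a + f \<notin> {u1, u2, u3} \<and>
    st + b + g \<notin> {t1, t2, t3} \<and> sv + a + b + y \<notin> {w1, w2, w3} \<and>
    sv + b + y \<noteq> su + f \<and> sv + a + y \<noteq> st + g"
    using p(2) unfolding coords(1)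
    by (simp add: dot_def add_diff_eq eq_diff_eq diff_eq_eq add_ac flip: of_nat_add)
  then show thesis using that[of a f y b g] coords U T W by blast
qed

section \<open>Sums of distinct representatives\<close>

lemma ex_not_in_if_card_less: "finite B \<Longrightarrow> card B < card A \<Longrightarrow> \<exists>a\<in>A. a \<notin> B"
  by (metis card_mono not_le subsetI)

definition sdr :: "'i set \<Rightarrow> ('i \<Rightarrow> 'a set) \<Rightarrow> ('i \<Rightarrow> 'a) \<Rightarrow> bool" where
  "sdr I A x \<longleftrightarrow> inj_on x I \<and> (\<forall>i\<in>I. x i \<in> A i)"

lemma sdr_mono: "sdr I A x \<Longrightarrow> (\<And>i. i \<in> I \<Longrightarrow> A i \<subseteq> B i) \<Longrightarrow> sdr I B x"
  unfolding sdr_def by blast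

lemma sdr_fun_upd:
  assumes "i \<notin> I" "sdr I A x" "a \<in> A i" "a \<notin> x ` I"
  shows "sdr (insert i I) A (x(i := a))"
  using assms inj_on_fun_updI[of x I a i] by (auto simp: sdr_def fun_upd_image)

text \<open>Equivalently, the sets can be ordered so that the \<open>i\<close>-th one (counting from 1) has at least \<open>i + e\<close>
  elements.\<close>

definition surplus :: "'i set \<Rightarrow> ('i \<Rightarrow> 'a set) \<Rightarrow> nat \<Rightarrow> bool" where
  "surplus I A e \<longleftrightarrow> (\<forall>J\<subseteq>I. J \<noteq> {} \<longrightarrow> (\<exists>j\<in>J. card J + e \<le> card (A j)))"

lemma surplusE:
  assumes "surplus I A e" "J \<subseteq> I" "J \<noteq> {}"
  obtains j where "j \<in> J" "card J + e \<le> card (A j)"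
  using assms unfolding surplus_def by blast

lemma surplus_subset: "surplus I A e \<Longrightarrow> J \<subseteq> I \<Longrightarrow> surplus J A e"
  unfolding surplus_def by (meson subset_trans)

lemma surplus_cong: "(\<And>i. i \<in> I \<Longrightarrow> A i = B i) \<Longrightarrow> surplus I A e \<longleftrightarrow> surplus I B e"
  unfolding surplus_def by (metis subsetD)

lemma surplusI_card:
  assumes "finite I" "\<And>i. i \<in> I \<Longrightarrow> card I + e \<le> card (A i)"
  shows "surplus I A e"
  unfolding surplus_def
proof (intro allI impI)
  fix J assume J: "J \<subseteq> I" "J \<noteq> {}"
  then obtain j where "j \<in> J" by blast
  moreover have "card J \<le> card I" using J assms(1) by (intro card_mono)
  ultimately show "\<exists>j\<in>J. card J + e \<le> card (A j)" using assms(2)[of j] J by (intro bexI[of _ j]) auto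
qed

lemma surplus_insert_large:
  assumes "finite I" "surplus I A e" "card (insert i I) + e \<le> card (A i)"
  shows "surplus (insert i I) A e"
  unfolding surplus_def
proof (intro allI impI)
  fix J assume J: "J \<subseteq> insert i I" "J \<noteq> {}"
  show "\<exists>j\<in>J. card J + e \<le> card (A j)"
  proof (cases "i \<in> J")
    case True
    have "card J \<le> card (insert i I)" using J(1) assms(1) by (intro card_mono) auto
    then show ?thesis using True assms(3) by (intro bexI[of _ i]) auto
  next
    case False
    then show ?thesis using J assms(2) unfolding surplus_def by (meson subset_insert)
  qed
qed

lemma surplus_insert_small:
  assumes "finite I" "surplus I A (Suc e)" "Suc e \<le> card (A i)"
  shows "surplus (insert i I) A e"
  unfolding surplus_def
proof (intro allI impI)
  fix J assume J: "J \<subseteq> insert i I" "J \<noteq> {}"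
  show "\<exists>j\<in>J. card J + e \<le> card (A j)"
  proof (cases "J = {i}")
    case True
    then show ?thesis using assms(3) by simp
  next
    case False
    then obtain j where j: "j \<in> J - {i}" "card (J - {i}) + Suc e \<le> card (A j)"
      using surplusE[OF assms(2), of "J - {i}"] J by blast
    have "card J \<le> Suc (card (J - {i}))" using diff_card_le_card_Diff[of "{i}" J] by simp
    then show ?thesis using j by (intro bexI[of _ j]) auto
  qed
qed

lemma surplus_Diff:
  assumes "finite Z" "surplus I A e" "d + card Z \<le> e"
  shows "surplus I (\<lambda>i. A i - Z) d"
  unfolding surplus_def
proof (intro allI impI)
  fix J assume J: "J \<subseteq> I" "J \<noteq> {}"
  obtain j where j: "j \<in> J" "card J + e \<le> card (A j)" using surplusE[OF assms(2) J] .
  have "card (A j) - card Z \<le> card (A j - Z)" using assms(1) by (rule diff_card_le_card_Diff)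
  then show "\<exists>j\<in>J. card J + d \<le> card (A j - Z)" using j assms(3) by (intro bexI[of _ j]) auto
qed

lemma surplus_remove_choice:
  assumes I: "finite I" "i \<in> I" and A: "\<And>j. j \<in> I \<Longrightarrow> card I + e \<le> card (A j)" "finite (A i)"
    and C: "card I + e < card C"
  obtains y where "y \<in> C" "surplus I (\<lambda>j. A j - {y}) e"
proof -
  obtain L where L: "L \<subseteq> A i" "card L = card I + e" using A(1)[OF I(2)] by (rule obtain_subset_with_card_n)
  have "finite L" using L(1) A(2) by (rule finite_subset)
  then obtain y where y: "y \<in> C" "y \<notin> L" using ex_not_in_if_card_less[of L C] L(2) C by auto
  have "card (I - {i}) + e \<le> card (A j - {y})" if "j \<in> I - {i}" for j
    using A(1)[of j] that I diff_card_le_card_Diff[of "{y}" "A j"] card_gt_0_iff[of I] by auto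
  then have "surplus (I - {i}) (\<lambda>j. A j - {y}) e" using I(1) by (intro surplusI_card) auto
  moreover have "L \<subseteq> A i - {y}" using L(1) y(2) by blast
  then have "card I + e \<le> card (A i - {y})" using A(2) L(2) card_mono[of "A i - {y}" L] by simp
  ultimately have "surplus (insert i (I - {i})) (\<lambda>j. A j - {y}) e"
    using I by (intro surplus_insert_large) (simp_all add: insert_absorb)
  then show thesis using that y(1) I(2) by (simp add: insert_absorb)
qed

lemma surplus_remove_value:
  assumes fin: "finite I" and surplus: "surplus I A e" and m: "\<exists>i\<in>I. m \<in> A i"
  shows "\<exists>i\<in>I. m \<in> A i \<and> surplus (I - {i}) (\<lambda>j. A j - {m}) e"
proof -
  let ?M = "{i \<in> I. m \<in> A i}"
  obtain i where i: "i \<in> ?M" and smallest: "\<And>j. j \<in> ?M \<Longrightarrow> card (A i) \<le> card (A j)"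
    using ex_min_if_finite[of "(\<lambda>i. card (A i)) ` ?M"] fin m by (auto simp: not_less)
  have "\<exists>j\<in>J. card J + e \<le> card (A j - {m})" if J: "J \<subseteq> I - {i}" "J \<noteq> {}" for J
  proof (cases "J \<inter> ?M = {}")
    case True
    then have "A j - {m} = A j" if "j \<in> J" for j using that J by auto
    moreover have "J \<subseteq> I" using J by auto
    ultimately show ?thesis using surplus J(2) unfolding surplus_def by metis
  next
    case False
    then obtain j' where j': "j' \<in> J" "j' \<in> ?M" by blast
    have "insert i J \<subseteq> I" using J i by auto
    with surplus obtain j where j: "j \<in> insert i J" "card (insert i J) + e \<le> card (A j)" by (rule surplusE) auto
    have "card (insert i J) = Suc (card J)"
      using J(1) fin by (subst card_insert_disjoint) (auto intro: finite_subset)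
    then obtain l where l: "l \<in> J" "Suc (card J) + e \<le> card (A l)"
      using j j'(1) smallest[OF j'(2)] by (cases "j = i") force+
    have "card (A l) - 1 \<le> card (A l - {m})" using diff_card_le_card_Diff[of "{m}" "A l"] by simp
    then show ?thesis using l by (intro bexI[of _ l]) auto
  qed
  then show ?thesis using i unfolding surplus_def by blast
qed

lemma sdr_exists:
  assumes "finite I" "\<And>i. i \<in> I \<Longrightarrow> finite (A i)" "surplus I A 0"
  shows "\<exists>x. sdr I A x"
  using assms
proof (induction "card I" arbitrary: I)
  case 0
  then show ?case by (simp add: sdr_def)
next
  case (Suc n)
  then have "I \<noteq> {}" by auto
  then obtain i where i: "i \<in> I" "card I \<le> card (A i)"
    using surplusE[OF Suc.prems(3), of I] by auto
  have n: "card (I - {i}) = n" using i Suc by simp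
  have "surplus (I - {i}) A 0" using Suc.prems(3) by (rule surplus_subset) auto
  then obtain x where x: "sdr (I - {i}) A x" using Suc.hyps(1)[of "I - {i}"] Suc.prems n by auto
  have "card (x ` (I - {i})) < card (A i)"
    using n i Suc.hyps(2) card_image_le[of "I - {i}" x] Suc.prems(1) by simp
  then obtain a where "a \<in> A i" "a \<notin> x ` (I - {i})"
    using ex_not_in_if_card_less[of "x ` (I - {i})"] Suc.prems(1) by auto
  then have "sdr I A (x(i := a))" using sdr_fun_upd[OF _ x, of i a] i(1) by (simp add: insert_absorb)
  then show ?case by blast
qed

text \<open>The exchange property of transversal matroids: any additional representatives \<open>\<psi>\<close> can be traded along an
  alternating path so that a single new value is used.\<close>

lemma sdr_augment:
  assumes "finite I" "i \<notin> I" "sdr I A \<phi>" "sdr (insert i I) A \<psi>"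
  shows "\<exists>\<chi> y. sdr (insert i I) A \<chi> \<and> \<chi> ` insert i I = insert y (\<phi> ` I) \<and> y \<notin> \<phi> ` I \<and> y \<in> \<psi> ` insert i I"
  using assms
proof (induction "card I" arbitrary: I i)
  case 0
  then show ?case by (intro exI[of _ \<psi>] exI[of _ "\<psi> i"]) auto
next
  case (Suc n)
  have \<psi>: "\<psi> i \<in> A i" using Suc.prems(4) by (simp add: sdr_def)
  show ?case
  proof (cases "\<psi> i \<in> \<phi> ` I")
    case False
    then have "sdr (insert i I) A (\<phi>(i := \<psi> i))" using Suc.prems \<psi> by (intro sdr_fun_upd)
    moreover have "(\<phi>(i := \<psi> i)) ` insert i I = insert (\<psi> i) (\<phi> ` I)" using Suc.prems(2) by (auto simp: fun_upd_image)
    ultimately show ?thesis using False by blast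
  next
    case True
    then obtain k where k: "k \<in> I" "\<psi> i = \<phi> k" by blast
    let ?J = "I - {k}"
    have J: "insert k ?J = I" using k(1) by blast
    have n: "n = card ?J" using Suc.hyps(2) k(1) Suc.prems(1) by simp
    have "sdr ?J A \<phi>" "sdr (insert k ?J) A \<psi>"
      using Suc.prems(3,4) unfolding J sdr_def by (blast intro: inj_on_subset)+
    then obtain \<chi> y where \<chi>: "sdr I A \<chi>" "\<chi> ` I = insert y (\<phi> ` ?J)" "y \<notin> \<phi> ` ?J" "y \<in> \<psi> ` I"
      using Suc.hyps(1)[OF n, of k] Suc.prems(1) unfolding J by blast
    have "\<psi> i \<notin> \<psi> ` I" using Suc.prems(2,4) by (simp add: sdr_def)
    then have y: "y \<noteq> \<psi> i" using \<chi>(4) by metis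
    have "\<phi> k \<notin> \<phi> ` ?J" using Suc.prems(3) k(1) by (auto simp: sdr_def inj_on_def)
    then have "sdr (insert i I) A (\<chi>(i := \<psi> i))"
      using \<chi>(1,2) y k(2) \<psi> Suc.prems(2) by (intro sdr_fun_upd) auto
    moreover have "(\<chi>(i := \<psi> i)) ` insert i I = insert (\<phi> k) (\<chi> ` I)"
      using k(2) Suc.prems(2) by (auto simp: fun_upd_image)
    then have "(\<chi>(i := \<psi> i)) ` insert i I = insert y (\<phi> ` I)"
      unfolding \<chi>(2) using J by (metis image_insert insert_commute)
    moreover have "y \<notin> \<phi> ` I" using \<chi>(3) y k by auto
    ultimately show ?thesis using \<chi>(4) by blast
  qed
qed

definition sdr_exchanges :: "'i set \<Rightarrow> ('i \<Rightarrow> 'a set) \<Rightarrow> 'a set \<Rightarrow> 'a set" where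
  "sdr_exchanges I A P = {y. y \<notin> P \<and> (\<exists>\<chi>. sdr I A \<chi> \<and> \<chi> ` I = insert y P)}"

lemma sdr_exchanges_subset: "sdr_exchanges I A P \<subseteq> (\<Union>i\<in>I. A i)"
proof
  fix y assume "y \<in> sdr_exchanges I A P"
  then obtain \<chi> where "sdr I A \<chi>" "y \<in> \<chi> ` I" unfolding sdr_exchanges_def by blast
  then show "y \<in> (\<Union>i\<in>I. A i)" unfolding sdr_def by blast
qed

lemma card_sdr_exchanges:
  assumes I: "finite I" "i \<notin> I" and A: "\<And>j. j \<in> insert i I \<Longrightarrow> finite (A j)"
    and surplus: "surplus (insert i I) A e" and \<phi>: "sdr I A \<phi>"
  shows "e < card (sdr_exchanges (insert i I) A (\<phi> ` I))"
proof (rule ccontr)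
  let ?Z = "sdr_exchanges (insert i I) A (\<phi> ` I)"
  assume "\<not> e < card ?Z"
  moreover have "finite ?Z" using I(1) A by (intro finite_subset[OF sdr_exchanges_subset]) auto
  ultimately have "surplus (insert i I) (\<lambda>j. A j - ?Z) 0" using surplus_Diff[OF _ surplus, of ?Z 0] by simp
  then obtain \<psi> where \<psi>: "sdr (insert i I) (\<lambda>j. A j - ?Z) \<psi>"
    using sdr_exists[of "insert i I" "\<lambda>j. A j - ?Z"] I(1) A by auto
  then have "sdr (insert i I) A \<psi>" by (rule sdr_mono) auto
  then obtain \<chi> y where "sdr (insert i I) A \<chi>" "\<chi> ` insert i I = insert y (\<phi> ` I)" "y \<notin> \<phi> ` I" "y \<in> \<psi> ` insert i I"
    using sdr_augment[OF I \<phi>] by blast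
  then have "y \<in> ?Z" "y \<notin> ?Z" using \<psi> unfolding sdr_exchanges_def sdr_def by auto
  then show False by contradiction
qed

definition sdr_sums :: "'i set \<Rightarrow> ('i \<Rightarrow> nat set) \<Rightarrow> nat set" where
  "sdr_sums I A = {\<Sum>i\<in>I. x i |x. sdr I A x}"

lemma finite_sdr_sums:
  assumes "\<And>i. i \<in> I \<Longrightarrow> finite (A i)"
  shows "finite (sdr_sums I A)"
proof (rule finite_subset)
  show "sdr_sums I A \<subseteq> {..\<Sum>i\<in>I. Max (A i)}"
    using assms by (auto simp: sdr_sums_def sdr_def intro!: sum_mono)
qed simp

lemma sdr_sums_insert:
  assumes "finite I" "i \<notin> I" "m \<in> A i"
  shows "(+) m ` sdr_sums I (\<lambda>j. A j - {m}) \<subseteq> sdr_sums (insert i I) A"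
proof
  fix s assume "s \<in> (+) m ` sdr_sums I (\<lambda>j. A j - {m})"
  then obtain x where x: "s = m + sum x I" "sdr I (\<lambda>j. A j - {m}) x" by (auto simp: sdr_sums_def)
  then have "m \<notin> x ` I" "sdr I A x" by (auto simp: sdr_def)
  then have "sdr (insert i I) A (x(i := m))" using assms by (intro sdr_fun_upd)
  moreover have "sum (x(i := m)) (insert i I) = s" using x(1) assms by (auto intro: sum.cong)
  ultimately show "s \<in> sdr_sums (insert i I) A" unfolding sdr_sums_def by blast
qed

lemma sdr_sums_exchange:
  assumes "finite P" "y \<in> sdr_exchanges I A P"
  shows "\<Sum>P + y \<in> sdr_sums I A"
proof -
  obtain x where x: "y \<notin> P" "sdr I A x" "x ` I = insert y P"
    using assms(2) unfolding sdr_exchanges_def by blast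
  have "sum x I = \<Sum>(x ` I)" using x(2) by (simp add: sdr_def sum.reindex)
  then show ?thesis using x assms(1) unfolding sdr_sums_def by (auto intro: exI[of _ x])
qed

text \<open>In the largest sum that uses the least value \<open>m\<close>, it can be exchanged for at least \<open>e\<close> larger values.\<close>

lemma card_sdr_sums_insert:
  assumes I: "finite I" "i \<notin> I" and A: "\<And>j. j \<in> insert i I \<Longrightarrow> finite (A j)"
    and m: "m \<in> A i" "\<And>y. y \<in> (\<Union>j\<in>insert i I. A j) \<Longrightarrow> m \<le> y"
    and surplus: "surplus (insert i I) A e" and nonempty: "sdr_sums I (\<lambda>j. A j - {m}) \<noteq> {}"
  shows "card (sdr_sums I (\<lambda>j. A j - {m})) + e \<le> card (sdr_sums (insert i I) A)"
proof -
  let ?sums = "sdr_sums I (\<lambda>j. A j - {m})"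
  have fin: "finite ?sums" "finite (sdr_sums (insert i I) A)" using A by (auto intro!: finite_sdr_sums)
  then have "Max ?sums \<in> ?sums" using nonempty by (intro Max_in)
  then obtain \<phi> where \<phi>: "sdr I (\<lambda>j. A j - {m}) \<phi>" "Max ?sums = sum \<phi> I" by (auto simp: sdr_sums_def)
  let ?P = "\<phi> ` I"
  have P: "finite ?P" "\<Sum>?P = Max ?sums" using I(1) \<phi> by (simp_all add: sdr_def sum.reindex)
  let ?Z = "sdr_exchanges (insert i I) A ?P"
  have Z: "?Z \<subseteq> (\<Union>j\<in>insert i I. A j)" by (rule sdr_exchanges_subset)
  then have finZ: "finite ?Z" by (rule finite_subset) (use I(1) A in auto)
  have "sdr I A \<phi>" using \<phi>(1) by (rule sdr_mono) auto
  then have "e < card ?Z" using I A surplus by (intro card_sdr_exchanges)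
  then have exchanges: "e \<le> card (?Z - {m})" using finZ by (auto simp: card_Diff_singleton_if)
  let ?low = "(+) m ` ?sums" and ?high = "(+) (\<Sum>?P) ` (?Z - {m})"
  have "?low \<inter> ?high = {}"
  proof -
    have "s \<le> \<Sum>?P" if "s \<in> ?sums" for s using Max_ge[OF fin(1) that] P(2) by simp
    moreover have "m < y" if "y \<in> ?Z - {m}" for y using that m(2)[of y] Z by force
    ultimately show ?thesis by fastforce
  qed
  then have "card (?low \<union> ?high) = card ?sums + card (?Z - {m})"
    using fin(1) finZ by (simp add: card_Un_disjoint card_image)
  moreover have "?low \<union> ?high \<subseteq> sdr_sums (insert i I) A"
    using sdr_sums_insert[of I i m A] sdr_sums_exchange[OF P(1), of _ "insert i I" A] I m(1) by auto
  then have "card (?low \<union> ?high) \<le> card (sdr_sums (insert i I) A)" using fin(2) by (rule card_mono[rotated])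
  ultimately show ?thesis using exchanges by linarith
qed

theorem card_sdr_sums:
  assumes "finite I" "\<And>i. i \<in> I \<Longrightarrow> finite (A i)" "surplus I A e"
  shows "card I * e < card (sdr_sums I A)"
  using assms
proof (induction "card I" arbitrary: I A)
  case 0
  then have "sdr_sums I A = {0}" by (auto simp: sdr_sums_def sdr_def)
  then show ?case using 0 by simp
next
  case (Suc n)
  let ?U = "\<Union>i\<in>I. A i"
  have "I \<noteq> {}" using Suc.hyps(2) by auto
  then obtain j where "j \<in> I" "card I + e \<le> card (A j)" using surplusE[OF Suc.prems(3), of I] by blast
  then have U: "?U \<noteq> {}" "finite ?U" using Suc.hyps(2) Suc.prems(1,2) by fastforce+
  define m where "m = Min ?U"
  have m: "m \<in> ?U" "\<And>y. y \<in> ?U \<Longrightarrow> m \<le> y"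
    unfolding m_def using Min_in[OF U(2,1)] Min_le[OF U(2)] by blast+
  then obtain i where i: "i \<in> I" "m \<in> A i" "surplus (I - {i}) (\<lambda>j. A j - {m}) e"
    using surplus_remove_value[OF Suc.prems(1,3), of m] by blast
  have I: "insert i (I - {i}) = I" "n = card (I - {i})" "finite (I - {i})" using i(1) Suc by auto
  have IH: "n * e < card (sdr_sums (I - {i}) (\<lambda>j. A j - {m}))"
    using Suc.hyps(1)[OF I(2), of "\<lambda>j. A j - {m}"] Suc.prems(2) I(2,3) i(3) by simp
  have "card (sdr_sums (I - {i}) (\<lambda>j. A j - {m})) + e \<le> card (sdr_sums (insert i (I - {i})) A)"
  proof (rule card_sdr_sums_insert[OF I(3)])
    show "sdr_sums (I - {i}) (\<lambda>j. A j - {m}) \<noteq> {}" using IH by force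
  qed (use I(1) i(2) m(2) Suc.prems(2,3) in auto)
  then show ?case using IH unfolding I(1) Suc.hyps(2)[symmetric] by simp
qed

corollary sdr_avoiding_sums:
  fixes A :: "'i \<Rightarrow> nat set"
  assumes "finite I" "\<And>i. i \<in> I \<Longrightarrow> finite (A i)" "surplus I A e" "finite W" "card W \<le> card I * e"
  obtains x where "sdr I A x" "c + (\<Sum>i\<in>I. x i) \<notin> W"
proof -
  have "card W < card ((+) c ` sdr_sums I A)"
    using card_sdr_sums[OF assms(1-3)] assms(5) by (simp add: card_image)
  then have "\<not> (+) c ` sdr_sums I A \<subseteq> W" using card_mono[OF assms(4)] by (metis not_less)
  then show thesis using that by (auto simp: sdr_sums_def)
qed

corollary sdr_insert_avoiding_sums:
  fixes A :: "'i \<Rightarrow> nat set"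
  assumes I: "finite I" "i \<notin> I" and A: "\<And>j. j \<in> I \<Longrightarrow> finite (A j)" "surplus I A (Suc e)" and a: "a \<in> A i"
    and W: "finite W" "card W \<le> card I * e"
  obtains x where "sdr (insert i I) A x" "x i = a" "c + (\<Sum>j\<in>insert i I. x j) \<notin> W"
proof -
  have "surplus I (\<lambda>j. A j - {a}) e" using A(2) by (rule surplus_Diff[rotated]) simp_all
  moreover have "finite (A j - {a})" if "j \<in> I" for j using A(1)[OF that] by simp
  ultimately obtain x where x: "sdr I (\<lambda>j. A j - {a}) x" "c + a + sum x I \<notin> W"
    using sdr_avoiding_sums[OF I(1) _ _ W, of "\<lambda>j. A j - {a}"] by metis
  then have "a \<notin> x ` I" "sdr I A x" by (auto simp: sdr_def)
  then have "sdr (insert i I) A (x(i := a))" using I(2) a by (intro sdr_fun_upd)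
  moreover have "sum (x(i := a)) (insert i I) = a + sum x I" using I by (auto intro: sum.cong)
  ultimately show thesis using that[of "x(i := a)"] x(2) by (simp add: add.assoc)
qed

section \<open>Partial colourings\<close>

definition nbrs :: "'a set set \<Rightarrow> 'a \<Rightarrow> 'a set" where
  "nbrs E v = {u. {v, u} \<in> E}"

lemma nbrs_sym: "u \<in> nbrs E v \<longleftrightarrow> v \<in> nbrs E u"
  by (simp add: nbrs_def insert_commute)

lemma simple_graph_subset: "simple_graph V E \<Longrightarrow> E' \<subseteq> E \<Longrightarrow> simple_graph V E'"
  unfolding simple_graph_def by blast

lemma simple_graph_finite:
  assumes "simple_graph V E"
  shows "finite V" "finite E" "finite (incident_edges E v)" "finite (nbrs E v)"
proof -
  show "finite V" using assms by (simp add: simple_graph_def)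
  moreover have "E \<subseteq> Pow V" "nbrs E v \<subseteq> V" using assms by (auto simp: simple_graph_def nbrs_def)
  ultimately show "finite E" "finite (nbrs E v)" by (auto intro: finite_subset)
  then show "finite (incident_edges E v)" by (simp add: incident_edges_def)
qed

lemma nbrs_subset: "simple_graph V E \<Longrightarrow> nbrs E v \<subseteq> V"
  unfolding simple_graph_def nbrs_def by auto

lemma not_self_nbr: "simple_graph V E \<Longrightarrow> v \<notin> nbrs E v"
  unfolding simple_graph_def nbrs_def by force

abbreviation star :: "'a \<Rightarrow> 'a set \<Rightarrow> 'a set set" where
  "star v T \<equiv> (\<lambda>u. {v, u}) ` T"

lemma inj_on_star: "inj_on (\<lambda>u. {v, u}) S"
  by (auto simp: inj_on_def doubleton_eq_iff)

lemma incident_edges_eq_star: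
  assumes "simple_graph V E"
  shows "incident_edges E v = star v (nbrs E v)"
proof
  show "incident_edges E v \<subseteq> star v (nbrs E v)"
  proof
    fix e assume "e \<in> incident_edges E v"
    then have e: "e \<in> E" "v \<in> e" "card e = 2" using assms unfolding incident_edges_def simple_graph_def by auto
    then obtain a b where "e = {a, b}" "a \<noteq> b" by (auto simp: card_2_iff)
    then have "e = {v, if a = v then b else a}" using e(2) by auto
    then show "e \<in> star v (nbrs E v)" using e(1) unfolding nbrs_def by blast
  qed
qed (auto simp: incident_edges_def nbrs_def)

lemma degree_eq_card_nbrs: "simple_graph V E \<Longrightarrow> degree E v = card (nbrs E v)"
  by (simp add: degree_def incident_edges_eq_star card_image inj_on_star)

definition partial_tnsd :: "'a set set \<Rightarrow> nat \<Rightarrow> 'a set \<Rightarrow> ('a \<Rightarrow> nat) \<Rightarrow> ('a set \<Rightarrow> nat) \<Rightarrow> bool" where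
  "partial_tnsd E k B f g \<longleftrightarrow>
     (\<forall>v\<in>B. f v \<in> {1..k}) \<and> (\<forall>e\<in>E. g e \<in> {1..k}) \<and>
     (\<forall>e1\<in>E. \<forall>e2\<in>E. e1 \<noteq> e2 \<and> e1 \<inter> e2 \<noteq> {} \<longrightarrow> g e1 \<noteq> g e2) \<and>
     (\<forall>e\<in>E. \<forall>v\<in>e \<inter> B. g e \<noteq> f v) \<and>
     (\<forall>u\<in>B. \<forall>v\<in>B. {u, v} \<in> E \<longrightarrow> f u \<noteq> f v \<and> colour_sum E f g u \<noteq> colour_sum E f g v)"

lemma partial_tnsdI:
  assumes "\<And>v. v \<in> B \<Longrightarrow> f v \<in> {1..k}" "\<And>e. e \<in> E \<Longrightarrow> g e \<in> {1..k}"
    and "\<And>e1 e2. e1 \<in> E \<Longrightarrow> e2 \<in> E \<Longrightarrow> e1 \<noteq> e2 \<Longrightarrow> e1 \<inter> e2 \<noteq> {} \<Longrightarrow> g e1 \<noteq> g e2"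
    and "\<And>e v. e \<in> E \<Longrightarrow> v \<in> e \<Longrightarrow> v \<in> B \<Longrightarrow> g e \<noteq> f v"
    and "\<And>u v. u \<in> B \<Longrightarrow> v \<in> B \<Longrightarrow> {u, v} \<in> E \<Longrightarrow> f u \<noteq> f v \<and> colour_sum E f g u \<noteq> colour_sum E f g v"
  shows "partial_tnsd E k B f g"
  unfolding partial_tnsd_def by (intro conjI ballI impI; simp add: assms del: atLeastAtMost_iff One_nat_def)

lemma partial_tnsdD:
  assumes "partial_tnsd E k B f g"
  shows "v \<in> B \<Longrightarrow> f v \<in> {1..k}" "e \<in> E \<Longrightarrow> g e \<in> {1..k}"
    and "e1 \<in> E \<Longrightarrow> e2 \<in> E \<Longrightarrow> e1 \<noteq> e2 \<Longrightarrow> e1 \<inter> e2 \<noteq> {} \<Longrightarrow> g e1 \<noteq> g e2"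
    and "e \<in> E \<Longrightarrow> v \<in> e \<Longrightarrow> v \<in> B \<Longrightarrow> g e \<noteq> f v"
    and "u \<in> B \<Longrightarrow> v \<in> B \<Longrightarrow> {u, v} \<in> E \<Longrightarrow> f u \<noteq> f v"
    and "u \<in> B \<Longrightarrow> v \<in> B \<Longrightarrow> {u, v} \<in> E \<Longrightarrow> colour_sum E f g u \<noteq> colour_sum E f g v"
  using assms unfolding partial_tnsd_def by simp_all

lemma tnsd_colouring_iff_partial_tnsd:
  assumes "simple_graph V E"
  shows "tnsd_colouring V E k f g \<longleftrightarrow> partial_tnsd E k V f g"
proof -
  have "e \<inter> V = e" if "e \<in> E" for e using assms that unfolding simple_graph_def by auto
  then show ?thesis
    unfolding tnsd_colouring_def proper_total_colouring_def partial_tnsd_def by auto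
qed

lemma partial_tnsd_subset: "partial_tnsd E k B f g \<Longrightarrow> C \<subseteq> B \<Longrightarrow> partial_tnsd E k C f g"
  unfolding partial_tnsd_def by (simp add: subset_iff)

lemma inj_on_incident_edges: "partial_tnsd E k B f g \<Longrightarrow> inj_on g (incident_edges E v)"
  unfolding partial_tnsd_def incident_edges_def inj_on_def by blast

definition edge_sum :: "'a set set \<Rightarrow> ('a set \<Rightarrow> nat) \<Rightarrow> 'a \<Rightarrow> nat" where
  "edge_sum E g w = sum g (incident_edges E w)"

lemma colour_sum_eq_edge_sum: "colour_sum E f g w = f w + edge_sum E g w"
  by (simp add: colour_sum_def edge_sum_def)

definition nbr_sums :: "'a set set \<Rightarrow> 'a set \<Rightarrow> ('a \<Rightarrow> nat) \<Rightarrow> ('a set \<Rightarrow> nat) \<Rightarrow> 'a \<Rightarrow> nat set" where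
  "nbr_sums E B f g w = colour_sum E f g ` (nbrs E w \<inter> B)"

definition vertex_list :: "'a set set \<Rightarrow> nat \<Rightarrow> 'a set \<Rightarrow> ('a \<Rightarrow> nat) \<Rightarrow> ('a set \<Rightarrow> nat) \<Rightarrow> 'a \<Rightarrow> nat set" where
  "vertex_list E k B f g w = {1..k} - (g ` incident_edges E w \<union> f ` (nbrs E w \<inter> B))"

definition edge_list :: "'a set set \<Rightarrow> nat \<Rightarrow> ('a set \<Rightarrow> nat) \<Rightarrow> 'a \<Rightarrow> 'a \<Rightarrow> nat set" where
  "edge_list E k g v u = {1..k} - (g ` incident_edges E u \<union> g ` incident_edges E v)"

lemma vertex_list_iff:
  "c \<in> vertex_list E k B f g w \<longleftrightarrow>
    c \<in> {1..k} \<and> (\<forall>e\<in>incident_edges E w. g e \<noteq> c) \<and> (\<forall>u\<in>nbrs E w \<inter> B. f u \<noteq> c)"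
  by (auto simp: vertex_list_def)

lemma edge_list_iff:
  "c \<in> edge_list E k g v u \<longleftrightarrow> c \<in> {1..k} \<and> (\<forall>e\<in>incident_edges E u \<union> incident_edges E v. g e \<noteq> c)"
  by (auto simp: edge_list_def)

text \<open>In the following definition \<open>E\<close> is a graph from which the star with centre \<open>v\<close> and leaves \<open>T\<close> has been deleted,
  \<open>h\<close> recolours the vertices of the star that belong to \<open>B\<close>, and \<open>x u\<close> is the new colour of the edge \<open>{v, u}\<close>.\<close>

definition star_solution :: "'a set set \<Rightarrow> nat \<Rightarrow> 'a set \<Rightarrow> ('a \<Rightarrow> nat) \<Rightarrow> ('a set \<Rightarrow> nat) \<Rightarrow>
    'a \<Rightarrow> 'a set \<Rightarrow> ('a \<Rightarrow> nat) \<Rightarrow> ('a \<Rightarrow> nat) \<Rightarrow> bool" where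
  "star_solution E k B f g v T h x \<longleftrightarrow>
     inj_on x T \<and> (\<forall>u\<in>T. x u \<in> edge_list E k g v u \<and> x u \<noteq> h v) \<and>
     h v \<in> vertex_list E k B f g v \<and>
     h v + edge_sum E g v + sum x T \<notin> nbr_sums E B f g v \<and>
     (\<forall>u\<in>T \<inter> B. h u \<in> vertex_list E k B f g u \<and> h u \<noteq> x u \<and> h u \<noteq> h v \<and>
        h u + edge_sum E g u + x u \<notin> nbr_sums E B f g u \<and>
        h v + edge_sum E g v + sum x T \<noteq> h u + edge_sum E g u + x u)"

lemma star_solutionD:
  assumes "star_solution E k B f g v T h x"
  shows "inj_on x T" "u \<in> T \<Longrightarrow> x u \<in> edge_list E k g v u" "u \<in> T \<Longrightarrow> x u \<noteq> h v"
    "h v \<in> vertex_list E k B f g v" "h v + edge_sum E g v + sum x T \<notin> nbr_sums E B f g v"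
    "u \<in> T \<inter> B \<Longrightarrow> h u \<in> vertex_list E k B f g u" "u \<in> T \<inter> B \<Longrightarrow> h u \<noteq> x u" "u \<in> T \<inter> B \<Longrightarrow> h u \<noteq> h v"
    "u \<in> T \<inter> B \<Longrightarrow> h u + edge_sum E g u + x u \<notin> nbr_sums E B f g u"
    "u \<in> T \<inter> B \<Longrightarrow> h v + edge_sum E g v + sum x T \<noteq> h u + edge_sum E g u + x u"
  using assms unfolding star_solution_def by auto

lemma nbrs_delete_star_centre: "nbrs (E - star v T) v = nbrs E v - T"
  by (auto simp: nbrs_def doubleton_eq_iff)

lemma nbrs_delete_star_leaf:
  "u \<in> T \<Longrightarrow> v \<notin> T \<Longrightarrow> nbrs (E - star v T) u = nbrs E u - {v}"
  by (auto simp: nbrs_def doubleton_eq_iff insert_commute)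

lemma incident_delete_star_centre:
  "star v T \<subseteq> E \<Longrightarrow> incident_edges E v = incident_edges (E - star v T) v \<union> star v T"
  by (auto simp: incident_edges_def)

lemma incident_delete_star_leaf:
  "star v T \<subseteq> E \<Longrightarrow> u \<in> T \<Longrightarrow> v \<notin> T \<Longrightarrow> incident_edges E u = insert {v, u} (incident_edges (E - star v T) u)"
  by (auto simp: incident_edges_def)

lemma incident_delete_star_other:
  "w \<noteq> v \<Longrightarrow> w \<notin> T \<Longrightarrow> incident_edges E w = incident_edges (E - star v T) w"
  by (auto simp: incident_edges_def)

locale star_recolouring =
  fixes V :: "'a set" and E :: "'a set set" and k :: nat and v :: 'a and T B :: "'a set"
    and f :: "'a \<Rightarrow> nat" and g :: "'a set \<Rightarrow> nat" and h x :: "'a \<Rightarrow> nat"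
  assumes graph: "simple_graph V E" and leaves: "T \<subseteq> nbrs E v"
    and leaves_nonadjacent: "\<And>u w. u \<in> T \<inter> B \<Longrightarrow> w \<in> T \<inter> B \<Longrightarrow> {u, w} \<notin> E"
    and old: "partial_tnsd (E - star v T) k (B - insert v T) f g"
    and solution: "star_solution (E - star v T) k B f g v T h x"
begin

abbreviation rest :: "'a set set" where
  "rest \<equiv> E - star v T"

definition recoloured :: "'a set" where
  "recoloured = insert v (T \<inter> B)"

definition vertex_colour :: "'a \<Rightarrow> nat" where
  "vertex_colour w = (if w \<in> recoloured then h w else f w)"

definition edge_colour :: "'a set \<Rightarrow> nat" where
  "edge_colour e = (if e \<in> star v T then x (inv_into T (\<lambda>u. {v, u}) e) else g e)"

lemma star_subset: "star v T \<subseteq> E"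
  using leaves by (auto simp: nbrs_def)

lemma centre_not_leaf: "v \<notin> T"
  using leaves not_self_nbr[OF graph] by blast

lemma finite_rest: "finite (incident_edges rest w)" "finite T"
  using simple_graph_finite[OF simple_graph_subset[OF graph, of rest]] simple_graph_finite[OF graph] leaves
  by (auto intro: finite_subset)

lemma edge_colour_star: "u \<in> T \<Longrightarrow> edge_colour {v, u} = x u"
  using inv_into_f_f[OF inj_on_star, of u T v] by (simp add: edge_colour_def)

lemma edge_colour_rest: "e \<in> rest \<Longrightarrow> edge_colour e = g e"
  by (auto simp: edge_colour_def)

lemma edge_sum_rest: "edge_sum rest edge_colour w = edge_sum rest g w"
  unfolding edge_sum_def by (intro sum.cong) (auto simp: incident_edges_def edge_colour_rest)

lemma colour_sum_centre: "colour_sum E vertex_colour edge_colour v = h v + edge_sum rest g v + sum x T"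
proof -
  have "incident_edges rest v \<inter> star v T = {}" by (auto simp: incident_edges_def)
  then have "edge_sum E edge_colour v = edge_sum rest edge_colour v + (\<Sum>e\<in>star v T. edge_colour e)"
    unfolding edge_sum_def incident_delete_star_centre[OF star_subset] using finite_rest
    by (intro sum.union_disjoint) auto
  also have "(\<Sum>e\<in>star v T. edge_colour e) = sum x T"
    by (simp add: sum.reindex inj_on_star edge_colour_star)
  finally show ?thesis by (simp add: colour_sum_eq_edge_sum edge_sum_rest vertex_colour_def recoloured_def)
qed

lemma colour_sum_leaf:
  assumes "u \<in> T \<inter> B"
  shows "colour_sum E vertex_colour edge_colour u = h u + edge_sum rest g u + x u"
proof -
  have "{v, u} \<notin> incident_edges rest u" using assms by (auto simp: incident_edges_def)
  moreover have "incident_edges E u = insert {v, u} (incident_edges rest u)"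
    using assms star_subset centre_not_leaf by (intro incident_delete_star_leaf) auto
  ultimately have "edge_sum E edge_colour u = edge_colour {v, u} + edge_sum rest edge_colour u"
    using finite_rest(1) by (simp add: edge_sum_def)
  then show ?thesis
    using assms by (simp add: colour_sum_eq_edge_sum edge_sum_rest edge_colour_star vertex_colour_def recoloured_def)
qed

lemma colour_sum_other:
  assumes "w \<in> B - recoloured"
  shows "colour_sum E vertex_colour edge_colour w = colour_sum rest f g w"
proof -
  have "incident_edges E w = incident_edges rest w"
    using assms by (intro incident_delete_star_other) (auto simp: recoloured_def)
  then have "edge_sum E edge_colour w = edge_sum rest edge_colour w" by (simp add: edge_sum_def)
  then show ?thesis using assms by (simp add: colour_sum_eq_edge_sum edge_sum_rest vertex_colour_def)
qed

lemma edge_colour_star_rest: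
  assumes "u \<in> T" "e \<in> rest" "{v, u} \<inter> e \<noteq> {}"
  shows "edge_colour {v, u} \<noteq> edge_colour e"
proof -
  have "e \<in> incident_edges rest u \<union> incident_edges rest v" using assms by (auto simp: incident_edges_def)
  then have "x u \<noteq> g e" using star_solutionD(2)[OF solution assms(1)] by (auto simp: edge_list_iff)
  then show ?thesis using assms edge_colour_star edge_colour_rest by simp
qed

lemma edge_colours_distinct:
  assumes "e1 \<in> E" "e2 \<in> E" "e1 \<noteq> e2" "e1 \<inter> e2 \<noteq> {}"
  shows "edge_colour e1 \<noteq> edge_colour e2"
proof -
  consider u1 u2 where "u1 \<in> T" "e1 = {v, u1}" "u2 \<in> T" "e2 = {v, u2}"
    | u where "u \<in> T" "e1 = {v, u}" "e2 \<in> rest"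
    | u where "u \<in> T" "e2 = {v, u}" "e1 \<in> rest"
    | "e1 \<in> rest" "e2 \<in> rest"
    using assms(1,2) by blast
  then show ?thesis
  proof cases
    case 1
    then show ?thesis using star_solutionD(1)[OF solution] assms(3) by (auto simp: edge_colour_star inj_on_def)
  next
    case 2
    then show ?thesis using edge_colour_star_rest assms(4) by blast
  next
    case 3
    then show ?thesis using edge_colour_star_rest[of _ e1] assms(4) by (metis inf_commute)
  next
    case 4
    then show ?thesis using partial_tnsdD(3)[OF old] assms(3,4) by (simp add: edge_colour_rest)
  qed
qed

lemma edge_vertex_colours_distinct:
  assumes "e \<in> E" "w \<in> e" "w \<in> B"
  shows "edge_colour e \<noteq> vertex_colour w"
proof (cases "e \<in> star v T")
  case True
  then obtain u where u: "u \<in> T" "e = {v, u}" by blast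
  then have "w = v \<or> w = u \<and> u \<in> T \<inter> B" using assms by auto
  then show ?thesis
    using u star_solutionD(3,7)[OF solution, of u] centre_not_leaf
    by (auto simp: edge_colour_star vertex_colour_def recoloured_def)
next
  case False
  then have e: "e \<in> rest" "e \<in> incident_edges rest w" using assms by (auto simp: incident_edges_def)
  have "g e \<noteq> vertex_colour w"
  proof (cases "w \<in> recoloured")
    case True
    then have "h w \<in> vertex_list rest k B f g w"
      using star_solutionD(4,6)[OF solution] by (auto simp: recoloured_def)
    then show ?thesis using True e(2) by (auto simp: vertex_colour_def vertex_list_iff)
  next
    case False
    then have "w \<in> B - insert v T" using assms(3) by (auto simp: recoloured_def)
    then show ?thesis using partial_tnsdD(4)[OF old e(1) assms(2)] False by (simp add: vertex_colour_def)
  qed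
  then show ?thesis using e(1) by (simp add: edge_colour_rest)
qed

lemma adjacent_recoloured:
  assumes "a \<in> recoloured" "b \<in> B" "{a, b} \<in> E"
  shows "vertex_colour a \<noteq> vertex_colour b \<and>
    colour_sum E vertex_colour edge_colour a \<noteq> colour_sum E vertex_colour edge_colour b"
proof (cases "b \<in> recoloured")
  case True
  have "{w, w} \<notin> E" for w using not_self_nbr[OF graph, of w] by (simp add: nbrs_def)
  then consider "a = v" "b \<in> T \<inter> B" | "b = v" "a \<in> T \<inter> B"
    using assms True leaves_nonadjacent unfolding recoloured_def by auto
  then show ?thesis
    using star_solutionD(8,10)[OF solution] star_solutionD(8,10)[OF solution, THEN not_sym]
    by cases (auto simp: colour_sum_centre colour_sum_leaf vertex_colour_def recoloured_def)
next
  case False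
  then have "{a, b} \<notin> star v T" using assms by (auto simp: recoloured_def doubleton_eq_iff)
  then have b: "b \<in> nbrs rest a \<inter> B" using assms by (auto simp: nbrs_def)
  have h: "h a \<in> vertex_list rest k B f g a"
    using assms(1) star_solutionD(4,6)[OF solution] by (auto simp: recoloured_def)
  have "colour_sum E vertex_colour edge_colour a \<notin> nbr_sums rest B f g a"
    using assms(1) star_solutionD(5,9)[OF solution] unfolding recoloured_def
    by (auto simp: colour_sum_centre colour_sum_leaf)
  then show ?thesis
    using b h False assms(1) colour_sum_other[of b]
    by (auto simp: nbr_sums_def vertex_list_iff vertex_colour_def)
qed

lemma adjacent_distinct:
  assumes "a \<in> B" "b \<in> B" "{a, b} \<in> E"
  shows "vertex_colour a \<noteq> vertex_colour b \<and>
    colour_sum E vertex_colour edge_colour a \<noteq> colour_sum E vertex_colour edge_colour b"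
proof -
  consider "a \<in> recoloured" | "b \<in> recoloured" | "a \<notin> recoloured" "b \<notin> recoloured" by blast
  then show ?thesis
  proof cases
    case 1
    then show ?thesis using adjacent_recoloured assms by blast
  next
    case 2
    then show ?thesis using adjacent_recoloured[of b a] assms by (metis insert_commute)
  next
    case 3
    then have "{a, b} \<in> rest" "a \<in> B - insert v T" "b \<in> B - insert v T"
      using assms by (auto simp: recoloured_def doubleton_eq_iff)
    then show ?thesis
      using partial_tnsdD(5,6)[OF old] colour_sum_other 3 assms by (simp add: vertex_colour_def)
  qed
qed

theorem partial_tnsd_recoloured: "partial_tnsd E k B vertex_colour edge_colour"
proof (rule partial_tnsdI)
  show "vertex_colour w \<in> {1..k}" if "w \<in> B" for w
  proof (cases "w \<in> recoloured")
    case True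
    then have "h w \<in> vertex_list rest k B f g w"
      using star_solutionD(4,6)[OF solution] by (auto simp: recoloured_def)
    then show ?thesis using True by (simp add: vertex_colour_def vertex_list_iff)
  next
    case False
    then show ?thesis using that partial_tnsdD(1)[OF old, of w] by (simp add: vertex_colour_def recoloured_def)
  qed
  show "edge_colour e \<in> {1..k}" if "e \<in> E" for e
  proof (cases "e \<in> star v T")
    case True
    then show ?thesis using star_solutionD(2)[OF solution] by (auto simp: edge_colour_star edge_list_iff)
  next
    case False
    then show ?thesis using that partial_tnsdD(2)[OF old, of e] by (simp add: edge_colour_rest)
  qed
qed (fact edge_colours_distinct edge_vertex_colours_distinct adjacent_distinct)+

end

lemma extend_to_vertex:
  assumes graph: "simple_graph V E" and coloured: "partial_tnsd E k B f g" and v: "v \<notin> B" and low_degree: "3 * degree E v < k"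
  shows "\<exists>f g. partial_tnsd E k (insert v B) f g"
proof -
  let ?B = "insert v B" and ?N = "nbrs E v \<inter> B"
  have N: "nbrs E v \<inter> ?B = ?N" using not_self_nbr[OF graph] by auto
  have fin: "finite (nbrs E v)" "finite (incident_edges E v)" using simple_graph_finite[OF graph] by auto
  have card_N: "card ?N \<le> degree E v" unfolding degree_eq_card_nbrs[OF graph] using fin(1) by (intro card_mono) auto
  let ?bad = "g ` incident_edges E v \<union> f ` ?N \<union> (\<lambda>u. colour_sum E f g u - edge_sum E g v) ` ?N"
  have "card ?bad \<le> card (g ` incident_edges E v) + card (f ` ?N) + card ((\<lambda>u. colour_sum E f g u - edge_sum E g v) ` ?N)"
    by (meson card_Un_le add_le_mono1 order.trans)
  also have "\<dots> \<le> degree E v + degree E v + degree E v"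
    using fin card_image_le[of ?N] card_N card_image_le[OF fin(2)] unfolding degree_def
    by (intro add_mono) (auto intro: order.trans)
  finally have "card ?bad < card {1..k}" using low_degree by simp
  then obtain c where c: "c \<in> {1..k}" "c \<notin> ?bad"
    using ex_not_in_if_card_less[of ?bad "{1..k}"] fin by auto
  interpret star_recolouring V E k v "{}" ?B f g "\<lambda>_. c" "\<lambda>_. 0"
  proof
    show "partial_tnsd (E - star v {}) k (?B - insert v {}) f g" using coloured v by simp
    have "c + edge_sum E g v \<noteq> colour_sum E f g u" if "u \<in> ?N" for u using c(2) that by force
    then show "star_solution (E - star v {}) k ?B f g v {} (\<lambda>_. c) (\<lambda>_. 0)"
      using c by (auto simp: star_solution_def vertex_list_iff nbr_sums_def N)
  qed (use graph in auto)
  show ?thesis using partial_tnsd_recoloured by blast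
qed

lemma extend_to_low_degree_vertices:
  assumes graph: "simple_graph V E" and coloured: "partial_tnsd E k B f g" and subset: "B \<subseteq> V"
    and low_degree: "\<And>v. v \<in> V - B \<Longrightarrow> 3 * degree E v < k"
  shows "\<exists>f g. partial_tnsd E k V f g"
proof -
  have "\<exists>f g. partial_tnsd E k (B \<union> C) f g" if "finite C" "C \<subseteq> V - B" for C
    using that
  proof (induction C rule: finite_induct)
    case empty
    then show ?case using coloured by auto
  next
    case (insert v C)
    then show ?case using extend_to_vertex[OF graph, of k "B \<union> C" _ _ v] low_degree[of v] by auto
  qed
  then have "\<exists>f g. partial_tnsd E k (B \<union> (V - B)) f g" using simple_graph_finite(1)[OF graph] by blast
  then show ?thesis using subset by (simp add: Un_absorb1)
qed

section \<open>Deleting a star\<close>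

lemma sum_atMost_card_le:
  fixes A :: "nat set"
  assumes "finite A" "0 \<notin> A"
  shows "\<Sum>{..card A} \<le> \<Sum>A"
  using assms
proof (induction "card A" arbitrary: A)
  case 0
  then show ?case by simp
next
  case (Suc n)
  let ?m = "Max A"
  have "A \<noteq> {}" using Suc.hyps(2) by auto
  then have m: "?m \<in> A" using Suc.prems(1) by (intro Max_in)
  have "A \<subseteq> {1..?m}" using Suc.prems by (auto simp: Suc_le_eq intro: gr0I)
  then have "card A \<le> ?m" using card_mono[of "{1..?m}" A] by simp
  moreover have "n = card (A - {?m})" using Suc.hyps(2) Suc.prems(1) m by simp
  then have "\<Sum>{..n} \<le> \<Sum>(A - {?m})" using Suc.hyps(1)[of "A - {?m}"] Suc.prems by simp
  moreover have "\<Sum>A = ?m + \<Sum>(A - {?m})" using m Suc.prems(1) by (simp add: sum.remove)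
  ultimately show ?case unfolding Suc.hyps(2)[symmetric] by simp
qed

lemma sum_plus_sum_atMost_card_le:
  fixes A :: "nat set"
  assumes "A \<subseteq> {1..k}"
  shows "\<Sum>A + \<Sum>{..card A} \<le> card A * (k + 1)"
proof -
  have fin: "finite A" using assms finite_subset by auto
  let ?r = "\<lambda>a. k + 1 - a"
  have inj: "inj_on ?r A" using assms by (auto simp: inj_on_def subset_iff)
  have "\<Sum>{..card (?r ` A)} \<le> \<Sum>(?r ` A)" using assms fin by (intro sum_atMost_card_le) auto
  then have "\<Sum>{..card A} \<le> (\<Sum>a\<in>A. k + 1 - a)" using inj by (simp add: card_image sum.reindex)
  moreover have "(\<Sum>a\<in>A. k + 1 - a) + \<Sum>A = (\<Sum>a\<in>A. k + 1)"
    unfolding sum.distrib[symmetric] using assms by (intro sum.cong) auto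
  ultimately show ?thesis by simp
qed

lemma colour_sum_le:
  assumes graph: "simple_graph V E" and coloured: "partial_tnsd E k B f g" and w: "w \<in> B"
  shows "colour_sum E f g w + \<Sum>{..Suc (degree E w)} \<le> Suc (degree E w) * (k + 1)"
proof -
  let ?A = "insert (f w) (g ` incident_edges E w)"
  have fin: "finite (g ` incident_edges E w)" using simple_graph_finite(3)[OF graph] by simp
  have new: "f w \<notin> g ` incident_edges E w"
    using partial_tnsdD(4)[OF coloured _ _ w] by (force simp: incident_edges_def)
  have card: "card ?A = Suc (degree E w)"
    using fin new card_image[OF inj_on_incident_edges[OF coloured]] by (simp add: degree_def)
  have sum: "\<Sum>?A = colour_sum E f g w"
    using fin new by (simp add: colour_sum_def sum.reindex inj_on_incident_edges[OF coloured])
  have "?A \<subseteq> {1..k}"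
    using partial_tnsdD(1)[OF coloured w] partial_tnsdD(2)[OF coloured] by (auto simp: incident_edges_def)
  from sum_plus_sum_atMost_card_le[OF this] show ?thesis unfolding card sum .
qed

lemma le_card_Diff_plus_card:
  assumes "finite P"
  shows "k \<le> card ({1..k} - P) + card P"
  using diff_card_le_card_Diff[OF assms, of "{1..k}"] by simp

locale star_deletion =
  fixes V :: "'a set" and E :: "'a set set" and k :: nat and v :: 'a and T B :: "'a set"
    and f :: "'a \<Rightarrow> nat" and g :: "'a set \<Rightarrow> nat"
  assumes graph: "simple_graph V E" and leaves: "T \<subseteq> nbrs E v" and centre: "v \<in> B" and coloured_subset: "B \<subseteq> V"
    and leaves_nonadjacent: "\<And>u w. u \<in> T \<inter> B \<Longrightarrow> w \<in> T \<inter> B \<Longrightarrow> {u, w} \<notin> E"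
    and low_degree: "\<And>w. w \<in> V - B \<Longrightarrow> 3 * degree E w < k"
    and deleted: "tnsd_colouring V (E - star v T) k f g"
begin

abbreviation rest :: "'a set set" where
  "rest \<equiv> E - star v T"

abbreviation edge_colours :: "'a \<Rightarrow> nat set" where
  "edge_colours \<equiv> edge_list rest k g v"

abbreviation vertex_colours :: "'a \<Rightarrow> nat set" where
  "vertex_colours \<equiv> vertex_list rest k B f g"

abbreviation rest_sum :: "'a \<Rightarrow> nat" where
  "rest_sum \<equiv> edge_sum rest g"

abbreviation sums_nearby :: "'a \<Rightarrow> nat set" where
  "sums_nearby \<equiv> nbr_sums rest B f g"

abbreviation star_solved :: "('a \<Rightarrow> nat) \<Rightarrow> ('a \<Rightarrow> nat) \<Rightarrow> bool" where
  "star_solved \<equiv> star_solution rest k B f g v T"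

lemma rest_graph: "simple_graph V rest"
  using graph by (rule simple_graph_subset) auto

lemma rest_coloured: "partial_tnsd rest k V f g"
  using deleted tnsd_colouring_iff_partial_tnsd[OF rest_graph] by blast

lemma finite_nbrs_incident_edges [simp]:
  "finite (nbrs E w)" "finite (nbrs rest w)" "finite (incident_edges rest w)"
  using simple_graph_finite[OF graph] simple_graph_finite[OF rest_graph] by auto

lemma finite_leaves: "finite T"
  using leaves finite_subset by fastforce

lemma centre_not_leaf: "v \<notin> T"
  using leaves not_self_nbr[OF graph] by blast

lemma degree_rest_centre: "degree rest v = degree E v - card T"
  unfolding degree_eq_card_nbrs[OF graph] degree_eq_card_nbrs[OF rest_graph] nbrs_delete_star_centre
  by (rule card_Diff_subset[OF finite_leaves leaves])

lemma degree_rest_leaf: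
  assumes "u \<in> T"
  shows "degree rest u = degree E u - 1"
proof -
  have "v \<in> nbrs E u" using leaves assms nbrs_sym[of u E v] by auto
  then show ?thesis
    unfolding degree_eq_card_nbrs[OF graph] degree_eq_card_nbrs[OF rest_graph]
      nbrs_delete_star_leaf[OF assms centre_not_leaf] by (rule card_Diff_singleton)
qed

lemma card_nbrs_rest_le: "card (nbrs rest w \<inter> B) \<le> degree rest w"
  unfolding degree_eq_card_nbrs[OF rest_graph] by (intro card_mono) auto

lemma card_used_le: "card (g ` incident_edges rest w) \<le> degree rest w"
  unfolding degree_def by (intro card_image_le) simp

lemma finite_lists [simp]: "finite (edge_colours u)" "finite (vertex_colours w)" "finite (sums_nearby w)"
  by (simp_all add: edge_list_def vertex_list_def nbr_sums_def)

lemma card_edge_colours: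
  assumes "u \<in> T"
  shows "k \<le> card (edge_colours u) + (degree E u - 1) + (degree E v - card T)"
proof -
  have "card (g ` incident_edges rest u \<union> g ` incident_edges rest v) \<le> degree rest u + degree rest v"
    using card_used_le[of u] card_used_le[of v] card_Un_le order.trans add_mono by meson
  then show ?thesis
    using le_card_Diff_plus_card[of "g ` incident_edges rest u \<union> g ` incident_edges rest v" k]
    by (simp add: edge_list_def degree_rest_centre degree_rest_leaf[OF assms])
qed

lemma card_vertex_colours: "k \<le> card (vertex_colours w) + degree rest w + card (nbrs rest w \<inter> B)"
proof -
  have "card (g ` incident_edges rest w \<union> f ` (nbrs rest w \<inter> B)) \<le> degree rest w + card (nbrs rest w \<inter> B)"
    by (intro order.trans[OF card_Un_le] add_mono card_used_le card_image_le) simp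
  then show ?thesis
    using le_card_Diff_plus_card[of "g ` incident_edges rest w \<union> f ` (nbrs rest w \<inter> B)" k] by (simp add: vertex_list_def)
qed

lemma card_vertex_colours_leaf: "u \<in> T \<Longrightarrow> k \<le> card (vertex_colours u) + 2 * (degree E u - 1)"
  using card_vertex_colours[of u] card_nbrs_rest_le[of u] by (simp add: degree_rest_leaf)

lemma nbrs_rest_centre: "nbrs rest v \<inter> B = nbrs E v \<inter> B - T"
  unfolding nbrs_delete_star_centre by blast

lemma card_vertex_colours_centre:
  "k \<le> card (vertex_colours v) + (degree E v - card T) + card (nbrs E v \<inter> B - T)"
  using card_vertex_colours[of v] unfolding nbrs_rest_centre degree_rest_centre .

lemma old_centre_colour: "f v \<in> vertex_colours v"
proof -
  have v: "v \<in> V" using centre coloured_subset by blast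
  have "g e \<noteq> f v" if "e \<in> incident_edges rest v" for e
    using partial_tnsdD(4)[OF rest_coloured _ _ v] that by (auto simp: incident_edges_def)
  moreover have "f u \<noteq> f v" if "u \<in> nbrs rest v \<inter> B" for u
    using partial_tnsdD(5)[OF rest_coloured v, of u] that coloured_subset by (force simp: nbrs_def)
  ultimately show ?thesis using partial_tnsdD(1)[OF rest_coloured v] by (simp add: vertex_list_iff)
qed

lemma card_sums_nearby_le: "card (sums_nearby w) \<le> card (nbrs rest w \<inter> B)"
  unfolding nbr_sums_def by (intro card_image_le) simp

lemma card_sums_nearby_centre: "card (sums_nearby v) \<le> card (nbrs E v \<inter> B - T)"
  using card_sums_nearby_le[of v] unfolding nbrs_rest_centre .

lemma card_sums_nearby_leaf: "u \<in> T \<Longrightarrow> card (sums_nearby u) \<le> degree E u - 1"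
  using card_sums_nearby_le[of u] card_nbrs_rest_le[of u] by (simp add: degree_rest_leaf)

lemma card_large_sums_nearby:
  "card {s \<in> sums_nearby v. Suc d * (k + 1) < s + \<Sum>{..Suc d}} \<le> card {u \<in> nbrs E v \<inter> B - T. degree E u \<noteq> d}"
proof -
  have "colour_sum rest f g w + \<Sum>{..Suc d} \<le> Suc d * (k + 1)"
    if w: "w \<in> nbrs E v \<inter> B - T" "degree E w = d" for w
  proof -
    have "incident_edges rest w = incident_edges E w"
      using w not_self_nbr[OF graph, of v] by (intro incident_delete_star_other[symmetric]) auto
    then have "degree rest w = d" using w(2) by (simp add: degree_def)
    moreover have "w \<in> V" using w(1) coloured_subset by blast
    ultimately show ?thesis using colour_sum_le[OF rest_graph rest_coloured, of w] by simp
  qed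
  then have "{s \<in> sums_nearby v. Suc d * (k + 1) < s + \<Sum>{..Suc d}} \<subseteq>
      colour_sum rest f g ` {u \<in> nbrs E v \<inter> B - T. degree E u \<noteq> d}"
    unfolding nbr_sums_def nbrs_rest_centre by (fastforce simp: not_le[symmetric])
  then show ?thesis by (intro surj_card_le) auto
qed

lemma centre_sum_ge:
  assumes y: "y \<in> vertex_colours v" and x: "sdr T (\<lambda>u. edge_colours u - {y}) x"
  shows "\<Sum>{..Suc (degree E v)} \<le> y + rest_sum v + sum x T"
proof -
  let ?U = "g ` incident_edges rest v"
  have U: "card ?U = degree E v - card T" "\<Sum>?U = rest_sum v"
    using inj_on_incident_edges[OF rest_coloured, of v]
    by (simp_all add: card_image sum.reindex edge_sum_def flip: degree_rest_centre degree_def)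
  have X: "card (x ` T) = card T" "\<Sum>(x ` T) = sum x T"
    using x by (simp_all add: sdr_def card_image sum.reindex)
  have "?U \<inter> x ` T = {}" "y \<notin> ?U \<union> x ` T"
    using x y by (fastforce simp: sdr_def edge_list_iff vertex_list_iff)+
  then have card: "card (insert y (?U \<union> x ` T)) = Suc (degree E v - card T + card T)"
    and sum: "\<Sum>(insert y (?U \<union> x ` T)) = y + rest_sum v + sum x T"
    using U X finite_leaves by (simp_all add: card_Un_disjoint sum.union_disjoint)
  have "card T \<le> degree E v" unfolding degree_eq_card_nbrs[OF graph] using leaves by (intro card_mono) auto
  moreover have "0 \<notin> insert y (?U \<union> x ` T)"
    using x y partial_tnsdD(2)[OF rest_coloured] by (force simp: sdr_def edge_list_def vertex_list_def incident_edges_def)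
  then have "\<Sum>{..card (insert y (?U \<union> x ` T))} \<le> \<Sum>(insert y (?U \<union> x ` T))"
    using finite_leaves by (intro sum_atMost_card_le) auto
  ultimately show ?thesis unfolding card sum by simp
qed

lemma star_solution_low_degree_leaves:
  assumes "T \<inter> B = {}"
  shows "star_solved (\<lambda>_. y) x \<longleftrightarrow>
    y \<in> vertex_colours v \<and> sdr T (\<lambda>u. edge_colours u - {y}) x \<and> y + rest_sum v + sum x T \<notin> sums_nearby v"
  using assms by (auto simp: star_solution_def sdr_def)

lemma star_solution_one_coloured_leaf:
  assumes "T \<inter> B = {u}" "y \<in> vertex_colours v" "sdr T (\<lambda>w. edge_colours w - {y}) x"
    and "y + rest_sum v + sum x T \<notin> sums_nearby v" "y + rest_sum v + sum x T \<noteq> c + rest_sum u + x u"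
    and "c \<in> vertex_colours u - {x u, y}" "c + rest_sum u + x u \<notin> sums_nearby u"
  shows "star_solved ((\<lambda>_. y)(u := c)) x"
proof -
  have "u \<noteq> v" using assms(1) centre_not_leaf by blast
  then show ?thesis
    unfolding star_solution_def assms(1) using assms(2-) by (simp add: sdr_def)
qed

lemma leaf_coloursE:
  assumes "u \<in> T" "1 < card (vertex_colours u)" "Suc (degree E u) < card (edge_colours u)"
  obtains a c where "a \<in> edge_colours u - {y}" "c \<in> vertex_colours u - {a, y}"
    "c + rest_sum u + a \<notin> sums_nearby u"
proof -
  obtain c where c: "c \<in> vertex_colours u" "c \<noteq> y"
    using ex_not_in_if_card_less[of "{y}" "vertex_colours u"] assms(2) by auto
  let ?sums = "(\<lambda>s. s - (c + rest_sum u)) ` sums_nearby u"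
  have "v \<in> nbrs E u" using assms(1) leaves nbrs_sym[of u E v] by blast
  then have "0 < degree E u" by (auto simp: degree_eq_card_nbrs[OF graph] card_gt_0_iff)
  moreover have "card ?sums \<le> degree E u - 1"
    by (rule order.trans[OF card_image_le[OF finite_lists(3)] card_sums_nearby_leaf[OF assms(1)]])
  moreover have "card (insert y (insert c ?sums)) \<le> Suc (Suc (card ?sums))"
    by (simp add: card_insert_if)
  ultimately have "card (insert y (insert c ?sums)) \<le> Suc (degree E u)" by linarith
  then have "card (insert y (insert c ?sums)) < card (edge_colours u)" using assms(3) by (rule le_less_trans)
  then obtain a where a: "a \<in> edge_colours u" "a \<notin> insert y (insert c ?sums)"
    using ex_not_in_if_card_less[of "insert y (insert c ?sums)"] by auto
  have "c + rest_sum u + a \<notin> sums_nearby u"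
  proof
    assume "c + rest_sum u + a \<in> sums_nearby u"
    then have "c + rest_sum u + a - (c + rest_sum u) \<in> ?sums" by (rule imageI)
    then show False using a(2) by simp
  qed
  then show thesis using that a c by blast
qed

theorem colourable_if_star_solution:
  assumes "star_solved h x"
  shows "\<exists>f g. tnsd_colouring V E k f g"
proof -
  interpret recolouring: star_recolouring V E k v T B f g h x
  proof
    show "partial_tnsd rest k (B - insert v T) f g"
      using rest_coloured by (rule partial_tnsd_subset) (use coloured_subset in auto)
  qed (fact graph leaves leaves_nonadjacent assms)+
  show ?thesis
    using extend_to_low_degree_vertices[OF graph recolouring.partial_tnsd_recoloured coloured_subset low_degree]
      tnsd_colouring_iff_partial_tnsd[OF graph] by blast
qed

end

section \<open>Excluded configurations\<close>

definition big :: "'a set \<Rightarrow> 'a set set \<Rightarrow> 'a set" where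
  "big V E = {v \<in> V. 4 \<le> degree E v}"

definition big_nbrs :: "'a set set \<Rightarrow> 'a \<Rightarrow> 'a set" where
  "big_nbrs E v = {u \<in> nbrs E v. 4 \<le> degree E u}"

definition small_nbrs :: "'a set set \<Rightarrow> 'a \<Rightarrow> 'a set" where
  "small_nbrs E v = {u \<in> nbrs E v. degree E u \<le> 3}"

definition nbrs_of_degree :: "'a set set \<Rightarrow> 'a \<Rightarrow> nat \<Rightarrow> 'a set" where
  "nbrs_of_degree E v d = {u \<in> nbrs E v. degree E u = d}"

lemma finite_nbr_classes:
  assumes "simple_graph V E"
  shows "finite (big_nbrs E v)" "finite (small_nbrs E v)" "finite (nbrs_of_degree E v d)"
  using simple_graph_finite(4)[OF assms, of v] by (simp_all add: big_nbrs_def small_nbrs_def nbrs_of_degree_def)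

lemma degree_eq_big_plus_small:
  assumes "simple_graph V E"
  shows "degree E v = card (big_nbrs E v) + card (small_nbrs E v)"
proof -
  have "nbrs E v = big_nbrs E v \<union> small_nbrs E v" "big_nbrs E v \<inter> small_nbrs E v = {}"
    by (auto simp: big_nbrs_def small_nbrs_def)
  then show ?thesis
    unfolding degree_eq_card_nbrs[OF assms] using finite_nbr_classes[OF assms] by (simp add: card_Un_disjoint)
qed

locale minimal_counterexample =
  fixes V :: "'a set" and E :: "'a set set" and k :: nat
  assumes simple: "simple_graph V E" and k_ge_11: "11 \<le> k" and degree_le: "\<And>v. v \<in> V \<Longrightarrow> degree E v + 3 \<le> k"
    and uncolourable: "\<not> (\<exists>f g. tnsd_colouring V E k f g)"
    and colourable: "\<And>E'. E' \<subset> E \<Longrightarrow> \<exists>f g. tnsd_colouring V E' k f g"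
begin

lemma nbr_in_V: "u \<in> nbrs E v \<Longrightarrow> u \<in> V \<and> v \<in> V"
  using nbrs_subset[OF simple] nbrs_sym[of u E v] by blast

text \<open>The additional spare colour is gained by placing an edge to a neighbour of degree at most 2 last.\<close>

definition spare :: "'a \<Rightarrow> nat" where
  "spare v = k - (degree E v + 3) + (if \<exists>u\<in>nbrs E v. degree E u \<le> 2 then 1 else 0)"

end

locale minimal_star = minimal_counterexample V E k + star_deletion V E k v T "insert v (big V E)" f g
  for V :: "'a set" and E :: "'a set set" and k :: nat and v :: 'a and T :: "'a set"
    and f :: "'a \<Rightarrow> nat" and g :: "'a set \<Rightarrow> nat"
begin

lemma no_star_solution: "\<not> star_solved h x"
  using colourable_if_star_solution uncolourable by blast

lemma coloured_nbrs: "nbrs E v \<inter> insert v (big V E) - T = big_nbrs E v - T"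
  using nbr_in_V not_self_nbr[OF simple] by (auto simp: big_nbrs_def big_def)

lemma card_centre_bounds:
  "k \<le> card (vertex_colours v) + (degree E v - card T) + card (big_nbrs E v - T)"
  "card (sums_nearby v) \<le> card (big_nbrs E v - T)"
  using card_vertex_colours_centre card_sums_nearby_centre by (simp_all only: coloured_nbrs)

end

lemma (in minimal_counterexample) minimal_starE:
  assumes T: "T \<subseteq> nbrs E v" "T \<noteq> {}"
    and nonadjacent: "\<And>u w. u \<in> T \<inter> big V E \<Longrightarrow> w \<in> T \<inter> big V E \<Longrightarrow> {u, w} \<notin> E"
  obtains f g where "minimal_star V E k v T f g"
proof -
  have v: "v \<in> V" "v \<notin> T" using T nbr_in_V not_self_nbr[OF simple] by auto
  have "star v T \<subseteq> E" "star v T \<noteq> {}" using T by (auto simp: nbrs_def)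
  then have "E - star v T \<subset> E" by blast
  then obtain f g where "tnsd_colouring V (E - star v T) k f g" using colourable by blast
  then have "minimal_star V E k v T f g"
    using simple T v nonadjacent k_ge_11 by unfold_locales (auto simp: big_def)
  then show thesis by (rule that)
qed

locale small_star = minimal_star V E k v "small_nbrs E v" f g
  for V :: "'a set" and E :: "'a set set" and k :: nat and v :: 'a
    and f :: "'a \<Rightarrow> nat" and g :: "'a set \<Rightarrow> nat" +
  assumes small_nbr: "small_nbrs E v \<noteq> {}"
begin

abbreviation n_small :: nat where
  "n_small \<equiv> card (small_nbrs E v)"

abbreviation n_big :: nat where
  "n_big \<equiv> card (big_nbrs E v)"

lemma degree_centre: "degree E v = n_big + n_small" "degree E v + 3 \<le> k"
  using degree_eq_big_plus_small[OF simple] degree_le centre coloured_subset by auto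

lemma card_centre_bounds_small: "k \<le> card (vertex_colours v) + 2 * n_big" "card (sums_nearby v) \<le> n_big"
proof -
  have "big_nbrs E v - small_nbrs E v = big_nbrs E v" by (auto simp: big_nbrs_def small_nbrs_def)
  then show "k \<le> card (vertex_colours v) + 2 * n_big" "card (sums_nearby v) \<le> n_big"
    using card_centre_bounds degree_centre(1) by simp_all
qed

lemma surplus_edge_colours: "surplus (small_nbrs E v) edge_colours (Suc (spare v))"
proof -
  let ?T = "small_nbrs E v"
  have card: "n_small + k \<le> card (edge_colours u) + (degree E u - 1) + degree E v" if "u \<in> ?T" for u
    using card_edge_colours[OF that] degree_centre(1) by simp
  show ?thesis
  proof (cases "\<exists>u\<in>nbrs E v. degree E u \<le> 2")
    case False
    show ?thesis
    proof (rule surplusI_card[OF finite_leaves])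
      fix u assume u: "u \<in> ?T"
      then have "degree E u \<le> 3" by (simp add: small_nbrs_def)
      then show "n_small + Suc (spare v) \<le> card (edge_colours u)"
        using card[OF u] False degree_centre(2) by (simp add: spare_def)
    qed
  next
    case True
    then obtain w where w: "w \<in> ?T" "degree E w \<le> 2" by (auto simp: small_nbrs_def)
    have "0 < n_small" using w(1) finite_leaves by (auto simp: card_gt_0_iff)
    have "surplus (?T - {w}) edge_colours (Suc (spare v))"
    proof (rule surplusI_card)
      fix u assume "u \<in> ?T - {w}"
      then have u: "u \<in> ?T" "degree E u \<le> 3" by (simp_all add: small_nbrs_def)
      then show "card (?T - {w}) + Suc (spare v) \<le> card (edge_colours u)"
        using card[OF u(1)] True degree_centre(2) w(1) \<open>0 < n_small\<close> finite_leaves by (simp add: spare_def)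
    qed (simp add: finite_leaves)
    moreover have "n_small + Suc (spare v) \<le> card (edge_colours w)"
      using card[OF w(1)] w(2) True degree_centre(2) by (simp add: spare_def)
    ultimately have "surplus (insert w (?T - {w})) edge_colours (Suc (spare v))"
      using w(1) finite_leaves by (intro surplus_insert_large) (simp_all add: insert_absorb)
    then show ?thesis using w(1) by (simp add: insert_absorb)
  qed
qed

lemma sum_in_sums_nearby_if_sdr:
  assumes "y \<in> vertex_colours v" "sdr (small_nbrs E v) (\<lambda>u. edge_colours u - {y}) x"
  shows "y + rest_sum v + sum x (small_nbrs E v) \<in> sums_nearby v"
proof -
  have "small_nbrs E v \<inter> insert v (big V E) = {}"
    using centre_not_leaf by (auto simp: small_nbrs_def big_def)
  then show ?thesis using star_solution_low_degree_leaves no_star_solution assms by blast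
qed

lemma surplus_edge_colours_Diff: "surplus (small_nbrs E v) (\<lambda>u. edge_colours u - {y}) (spare v)"
  using surplus_edge_colours by (rule surplus_Diff[rotated]) simp_all

lemma n_small_mult_spare_less: "n_small * spare v < n_big"
proof (rule ccontr)
  assume "\<not> n_small * spare v < n_big"
  then have "card (sums_nearby v) \<le> n_small * spare v" using card_centre_bounds_small(2) by simp
  then obtain x where "sdr (small_nbrs E v) (\<lambda>u. edge_colours u - {f v}) x"
    "f v + rest_sum v + sum x (small_nbrs E v) \<notin> sums_nearby v"
    using sdr_avoiding_sums[OF finite_leaves _ surplus_edge_colours_Diff[of "f v"], of "sums_nearby v" "f v + rest_sum v"]
    by auto
  then show False using sum_in_sums_nearby_if_sdr[OF old_centre_colour] by blast
qed

lemma Suc_n_small_mult_less_if_surplus: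
  assumes "surplus (insert v (small_nbrs E v)) (edge_colours(v := vertex_colours v)) e"
  shows "Suc n_small * e < n_big"
proof (rule ccontr)
  let ?T = "small_nbrs E v" and ?A = "edge_colours(v := vertex_colours v)"
  assume "\<not> Suc n_small * e < n_big"
  then have "card (sums_nearby v) \<le> card (insert v ?T) * e"
    using card_centre_bounds_small(2) centre_not_leaf finite_leaves by simp
  moreover have "finite (?A u)" for u by simp
  ultimately obtain x where x: "sdr (insert v ?T) ?A x" "rest_sum v + sum x (insert v ?T) \<notin> sums_nearby v"
    using sdr_avoiding_sums[OF finite.insertI[OF finite_leaves] _ assms finite_lists(3), of v "rest_sum v"] by blast
  have "x u \<in> edge_colours u - {x v}" if "u \<in> ?T" for u
  proof -
    have "u \<noteq> v" using that centre_not_leaf by blast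
    then have "x u \<noteq> x v" "x u \<in> edge_colours u" using x(1) that by (auto simp: sdr_def inj_on_def)
    then show ?thesis by blast
  qed
  then have "x v \<in> vertex_colours v" "sdr ?T (\<lambda>u. edge_colours u - {x v}) x"
    using x(1) by (auto simp: sdr_def)
  then have "x v + rest_sum v + sum x ?T \<in> sums_nearby v" by (rule sum_in_sums_nearby_if_sdr)
  moreover have "rest_sum v + sum x (insert v ?T) = x v + rest_sum v + sum x ?T"
    using centre_not_leaf finite_leaves by simp
  ultimately show False using x(2) by (simp add: add_ac)
qed

lemma surplus_fun_upd_centre:
  "surplus (small_nbrs E v) (edge_colours(v := C)) e \<longleftrightarrow> surplus (small_nbrs E v) edge_colours e"
  using centre_not_leaf by (intro surplus_cong) auto

lemma Suc_n_small_mult_less: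
  assumes "e \<le> spare v" "2 * n_big + e < k"
  shows "Suc n_small * e < n_big"
proof (rule Suc_n_small_mult_less_if_surplus, rule surplus_insert_small[OF finite_leaves])
  show "surplus (small_nbrs E v) (edge_colours(v := vertex_colours v)) (Suc e)"
    unfolding surplus_fun_upd_centre using surplus_Diff[OF _ surplus_edge_colours, of "{}" "Suc e"] assms(1) by simp
qed (use card_centre_bounds_small(1) assms(2) in simp)

lemma n_big_ge_2: "2 \<le> n_big"
proof (rule ccontr)
  assume "\<not> 2 \<le> n_big"
  moreover have "Suc n_small * 1 < n_big" if "n_big \<le> 1"
  proof (rule Suc_n_small_mult_less_if_surplus, rule surplus_insert_large[OF finite_leaves])
    show "surplus (small_nbrs E v) (edge_colours(v := vertex_colours v)) 1"
      unfolding surplus_fun_upd_centre using surplus_Diff[OF _ surplus_edge_colours, of "{}" 1] by simp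
    show "card (insert v (small_nbrs E v)) + 1 \<le> card ((edge_colours(v := vertex_colours v)) v)"
      using card_centre_bounds_small(1) degree_centre that centre_not_leaf finite_leaves by simp
  qed
  ultimately show False by simp
qed

text \<open>For \<open>k = 11\<close> a vertex of degree 8 has sum at least \<open>1 + \<dots> + 9 = 45\<close>, one of degree 4 at most
  \<open>7 + \<dots> + 11 = 45\<close>. Avoiding the single value 45 at \<open>v\<close> thus deals with all neighbours of degree 4.\<close>

lemma card_nbrs_of_degree_4_le_2:
  assumes degree_v: "degree E v = 8" "n_small = 3" and low: "\<exists>u\<in>nbrs E v. degree E u \<le> 2"
  shows "card (nbrs_of_degree E v 4) \<le> 2"
proof (rule ccontr)
  let ?T = "small_nbrs E v" and ?Q = "nbrs_of_degree E v 4"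
  assume "\<not> card ?Q \<le> 2"
  have n_big: "n_big = 5" using degree_centre(1) degree_v by simp
  then have spare: "spare v = 1" and k_eq: "k = 11"
    using n_small_mult_spare_less degree_v low degree_centre(2) by (auto simp: spare_def)
  let ?W = "insert 45 {s \<in> sums_nearby v. 45 < s}"
  have "{u \<in> nbrs E v \<inter> insert v (big V E) - ?T. degree E u \<noteq> 4} = big_nbrs E v - ?Q"
    unfolding coloured_nbrs by (auto simp: big_nbrs_def small_nbrs_def nbrs_of_degree_def)
  moreover have "?Q \<subseteq> big_nbrs E v" by (auto simp: big_nbrs_def nbrs_of_degree_def)
  moreover have "Suc 4 * (k + 1) < s + \<Sum>{..Suc 4} \<longleftrightarrow> 45 < s" for s
    unfolding k_eq by (simp add: numeral_eq_Suc)
  ultimately have "card {s \<in> sums_nearby v. 45 < s} \<le> 5 - card ?Q"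
    using card_large_sums_nearby[of 4] n_big finite_nbr_classes[OF simple] by (simp add: card_Diff_subset)
  then have "card ?W \<le> card ?T * spare v"
    using \<open>\<not> card ?Q \<le> 2\<close> degree_v(2) spare card_insert_le_m1[of 3 "{s \<in> sums_nearby v. 45 < s}" 45] by simp
  then obtain x where x: "sdr ?T (\<lambda>u. edge_colours u - {f v}) x" "f v + rest_sum v + sum x ?T \<notin> ?W"
    using sdr_avoiding_sums[OF finite_leaves _ surplus_edge_colours_Diff[of "f v"], of ?W "f v + rest_sum v"] by auto
  have "45 \<le> f v + rest_sum v + sum x ?T"
    using centre_sum_ge[OF old_centre_colour x(1)] degree_v(1) by (simp add: numeral_eq_Suc)
  then show False using x sum_in_sums_nearby_if_sdr[OF old_centre_colour x(1)] by simp
qed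

end

context minimal_counterexample
begin

lemma small_starE:
  assumes "small_nbrs E v \<noteq> {}"
  obtains f g where "small_star V E k v f g"
proof -
  obtain f g where "minimal_star V E k v (small_nbrs E v) f g"
    by (rule minimal_starE[of "small_nbrs E v" v]) (use assms in \<open>auto simp: small_nbrs_def big_def\<close>)
  then show thesis using that assms by (simp add: small_star_def small_star_axioms_def)
qed

lemma n_small_mult_less:
  assumes "small_nbrs E v \<noteq> {}" "j \<le> spare v"
  shows "card (small_nbrs E v) * j < card (big_nbrs E v)"
proof -
  obtain f g where "small_star V E k v f g" using assms(1) by (rule small_starE)
  then have "card (small_nbrs E v) * spare v < card (big_nbrs E v)"
    by (rule small_star.n_small_mult_spare_less)
  then show ?thesis using assms(2) by (meson le_less_trans mult_le_mono2)
qed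

lemma Suc_n_small_mult_less:
  assumes "small_nbrs E v \<noteq> {}" "e \<le> spare v" "2 * card (big_nbrs E v) + e < k"
  shows "Suc (card (small_nbrs E v)) * e < card (big_nbrs E v)"
  using small_star.Suc_n_small_mult_less[OF _ assms(2,3)] small_starE[OF assms(1)] by metis

lemma n_small_add_2_le:
  assumes "small_nbrs E v \<noteq> {}" "1 \<le> spare v"
  shows "card (small_nbrs E v) + 2 \<le> card (big_nbrs E v)"
proof (rule ccontr)
  assume few: "\<not> card (small_nbrs E v) + 2 \<le> card (big_nbrs E v)"
  obtain u where "u \<in> nbrs E v" using assms(1) by (auto simp: small_nbrs_def)
  then have "degree E v + 3 \<le> k" using degree_le nbr_in_V by blast
  then have "2 * card (big_nbrs E v) + 1 < k" using few degree_eq_big_plus_small[OF simple, of v] by simp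
  then show False using Suc_n_small_mult_less[OF assms] few by simp
qed

lemma n_big_ge_2: "small_nbrs E v \<noteq> {} \<Longrightarrow> 2 \<le> card (big_nbrs E v)"
  using small_star.n_big_ge_2 small_starE by metis

lemma card_nbrs_of_degree_4_le_2:
  assumes "degree E v = 8" "card (small_nbrs E v) = 3" "\<exists>u\<in>nbrs E v. degree E u \<le> 2"
  shows "card (nbrs_of_degree E v 4) \<le> 2"
proof -
  have "small_nbrs E v \<noteq> {}" using assms(2) by auto
  then obtain f g where "small_star V E k v f g" by (rule small_starE)
  then show ?thesis using assms by (rule small_star.card_nbrs_of_degree_4_le_2)
qed

lemma degree_ge_6_if_small_nbr:
  assumes "small_nbrs E v \<noteq> {}"
  shows "6 \<le> degree E v"
proof (rule ccontr)
  assume degree_v: "\<not> 6 \<le> degree E v"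
  have "0 < card (small_nbrs E v)" using assms finite_nbr_classes(2)[OF simple] by (simp add: card_gt_0_iff)
  then have "card (big_nbrs E v) \<le> 4" using degree_v degree_eq_big_plus_small[OF simple, of v] by simp
  moreover have "2 \<le> spare v" using degree_v k_ge_11 by (simp add: spare_def)
  ultimately have "Suc (card (small_nbrs E v)) * 2 < card (big_nbrs E v)"
    using k_ge_11 by (intro Suc_n_small_mult_less[OF assms]) auto
  then show False using \<open>0 < card (small_nbrs E v)\<close> \<open>card (big_nbrs E v) \<le> 4\<close> by simp
qed

lemma degree_ge_5_if_nbr_of_degree_4:
  assumes u: "u \<in> nbrs E v" "degree E u = 4"
  shows "5 \<le> degree E v"
proof (rule ccontr)
  assume "\<not> 5 \<le> degree E v"
  moreover have "\<not> degree E v \<le> 3"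
  proof
    assume "degree E v \<le> 3"
    then have "v \<in> small_nbrs E u" using u(1) nbrs_sym[of u E v] by (simp add: small_nbrs_def)
    then show False using degree_ge_6_if_small_nbr[of u] u(2) by auto
  qed
  ultimately have degree_v: "degree E v = 4" by simp
  have star_vertices: "u \<noteq> v" "u \<in> big V E" using u nbr_in_V not_self_nbr[OF simple] by (auto simp: big_def)
  obtain f g where "minimal_star V E k v {u} f g"
    by (rule minimal_starE[of "{u}" v]) (use u(1) not_self_nbr[OF simple] in \<open>auto simp: nbrs_def\<close>)
  then interpret minimal_star V E k v "{u}" f g .
  have "card (big_nbrs E v - {u}) \<le> 3"
    using degree_eq_big_plus_small[OF simple, of v] degree_v u by (simp add: big_nbrs_def)
  then have sizes: "5 \<le> card (edge_colours u)" "5 \<le> card (vertex_colours v)" "3 \<le> card (vertex_colours u)"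
    "card (sums_nearby u) \<le> 3" "card (sums_nearby v) \<le> 3"
    using card_edge_colours[of u] card_vertex_colours_leaf[of u] card_sums_nearby_leaf[of u] card_centre_bounds u(2) degree_v k_ge_11
    by auto
  obtain a y c where "a \<in> edge_colours u" "y \<in> vertex_colours v" "c \<in> vertex_colours u"
    "a \<noteq> y" "a \<noteq> c" "y \<noteq> c" "rest_sum u + a + c \<notin> sums_nearby u" "rest_sum v + a + y \<notin> sums_nearby v"
    "rest_sum v + y \<noteq> rest_sum u + c"
    by (rule choose_edge_and_ends[OF sizes(1-3) finite_lists(3) sizes(4) finite_lists(3) sizes(5)])
  then have "star_solved ((\<lambda>_. y)(u := c)) (\<lambda>_. a)"
    using star_vertices by (simp add: star_solution_def add_ac)
  then show False using no_star_solution by blast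
qed

lemma card_nbrs_of_degree_4_le_1:
  assumes degree_v: "degree E v = 5"
  shows "card (nbrs_of_degree E v 4) \<le> 1"
proof (rule ccontr)
  assume "\<not> card (nbrs_of_degree E v 4) \<le> 1"
  then obtain u t where u: "u \<in> nbrs E v" "degree E u = 4" and t: "t \<in> nbrs E v" "degree E t = 4" and distinct: "u \<noteq> t"
    using card_le_Suc0_iff_eq[of "nbrs_of_degree E v 4"] finite_nbr_classes(3)[OF simple]
    by (auto simp: nbrs_of_degree_def)
  have star_vertices: "u \<noteq> v" "t \<noteq> v" "u \<in> big V E" "t \<in> big V E"
    using u t nbr_in_V not_self_nbr[OF simple] by (auto simp: big_def)
  have nonadjacent: "{u, t} \<notin> E" "{t, u} \<notin> E"
    using degree_ge_5_if_nbr_of_degree_4[of u t] degree_ge_5_if_nbr_of_degree_4[of t u] u t by (auto simp: nbrs_def)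
  obtain f g where "minimal_star V E k v {u, t} f g"
    by (rule minimal_starE[of "{u, t}" v]) (use u(1) t(1) nonadjacent not_self_nbr[OF simple] in \<open>auto simp: nbrs_def\<close>)
  then interpret minimal_star V E k v "{u, t}" f g .
  have "card (big_nbrs E v - {u, t}) \<le> 3"
    using degree_eq_big_plus_small[OF simple, of v] degree_v u t distinct by (simp add: big_nbrs_def card_Diff_insert)
  then have sizes: "5 \<le> card (edge_colours u)" "3 \<le> card (vertex_colours u)" "5 \<le> card (vertex_colours v)"
    "5 \<le> card (edge_colours t)" "5 \<le> card (vertex_colours t)"
    "card (sums_nearby u) \<le> 3" "card (sums_nearby t) \<le> 3" "card (sums_nearby v) \<le> 3"
    using card_edge_colours[of u] card_vertex_colours_leaf[of u] card_sums_nearby_leaf[of u]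
      card_edge_colours[of t] card_vertex_colours_leaf[of t] card_sums_nearby_leaf[of t] card_centre_bounds u(2) t(2) distinct degree_v k_ge_11
    by auto
  obtain a c y b c' where
    "a \<in> edge_colours u" "c \<in> vertex_colours u" "y \<in> vertex_colours v" "b \<in> edge_colours t" "c' \<in> vertex_colours t"
    "a \<noteq> b" "a \<noteq> y" "b \<noteq> y" "a \<noteq> c" "b \<noteq> c'" "y \<noteq> c" "y \<noteq> c'"
    "rest_sum u + a + c \<notin> sums_nearby u" "rest_sum t + b + c' \<notin> sums_nearby t"
    "rest_sum v + a + b + y \<notin> sums_nearby v"
    "rest_sum v + b + y \<noteq> rest_sum u + c" "rest_sum v + a + y \<noteq> rest_sum t + c'"
    by (rule choose_two_edges_and_three_ends[OF sizes(1-5) finite_lists(3) sizes(6) finite_lists(3) sizes(7)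
      finite_lists(3) sizes(8)])
  then have "star_solved ((\<lambda>_. y)(u := c, t := c')) ((\<lambda>_. a)(t := b))"
    using star_vertices distinct by (simp add: star_solution_def add_ac)
  then show False using no_star_solution by blast
qed

lemma no_nbrs_of_degree_4_if_degree_6:
  assumes degree_v: "degree E v = 6" and w: "w \<in> small_nbrs E v"
  shows "nbrs_of_degree E v 4 = {}"
proof (rule ccontr)
  assume "nbrs_of_degree E v 4 \<noteq> {}"
  then obtain u where u: "u \<in> nbrs E v" "degree E u = 4" by (auto simp: nbrs_of_degree_def)
  have w': "w \<in> nbrs E v" "degree E w \<le> 3" using w by (simp_all add: small_nbrs_def)
  have star_vertices: "u \<noteq> v" "w \<noteq> v" "u \<noteq> w" "u \<in> big V E" "w \<notin> big V E"
    using u w' nbr_in_V not_self_nbr[OF simple] by (auto simp: big_def)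
  obtain f g where "minimal_star V E k v {u, w} f g"
    by (rule minimal_starE[of "{u, w}" v]) (use u(1) w' star_vertices not_self_nbr[OF simple] in \<open>auto simp: nbrs_def\<close>)
  then interpret minimal_star V E k v "{u, w}" f g .
  have "0 < card (small_nbrs E v)" using w finite_nbr_classes(2)[OF simple] by (auto simp: card_gt_0_iff)
  moreover have "big_nbrs E v - {u, w} = big_nbrs E v - {u}" using w' by (auto simp: big_nbrs_def)
  ultimately have "card (big_nbrs E v - {u, w}) \<le> 4"
    using degree_eq_big_plus_small[OF simple, of v] degree_v u by (simp add: big_nbrs_def)
  then have sizes: "5 \<le> card (edge_colours w)" "4 \<le> card (edge_colours u)" "3 \<le> card (vertex_colours v)"
    "5 \<le> card (vertex_colours u)" "card (sums_nearby u) \<le> 3" "card (sums_nearby v) \<le> 4"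
    using card_edge_colours[of u] card_vertex_colours_leaf[of u] card_sums_nearby_leaf[of u]
      card_edge_colours[of w] card_centre_bounds u(2) w'(2) star_vertices(3) degree_v k_ge_11 by auto
  obtain b a y c where "b \<in> edge_colours w" "a \<in> edge_colours u" "y \<in> vertex_colours v" "c \<in> vertex_colours u"
    "b \<noteq> a" "b \<noteq> y" "a \<noteq> y" "a \<noteq> c" "y \<noteq> c" "rest_sum u + a + c \<notin> sums_nearby u"
    "rest_sum v + b + a + y \<notin> sums_nearby v" "rest_sum v + b + y \<noteq> rest_sum u + c"
    by (rule choose_small_edge_edge_and_ends[OF sizes(1-4) finite_lists(3) sizes(5) finite_lists(3) sizes(6)])
  then have "star_solved ((\<lambda>_. y)(u := c)) ((\<lambda>_. b)(u := a))"
    using star_vertices by (simp add: star_solution_def add_ac)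
  then show False using no_star_solution by blast
qed

lemma no_nbrs_of_degree_4_if_degree_7:
  assumes degree_v: "degree E v = 7" "card (small_nbrs E v) = 2" and w: "w \<in> nbrs E v" "degree E w \<le> 2"
  shows "nbrs_of_degree E v 4 = {}"
proof (rule ccontr)
  assume "nbrs_of_degree E v 4 \<noteq> {}"
  then obtain u where u: "u \<in> nbrs E v" "degree E u = 4" by (auto simp: nbrs_of_degree_def)
  have "w \<in> small_nbrs E v" using w by (simp add: small_nbrs_def)
  then have "card (small_nbrs E v - {w}) = 1" using degree_v(2) by simp
  then obtain z where "small_nbrs E v - {w} = {z}" by (rule card_1_singletonE)
  then have z: "z \<in> nbrs E v" "degree E z \<le> 3" "z \<noteq> w" by (auto simp: small_nbrs_def)
  have star_vertices: "u \<noteq> v" "w \<noteq> v" "z \<noteq> v" "u \<noteq> w" "u \<noteq> z" "u \<in> big V E" "w \<notin> big V E" "z \<notin> big V E"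
    using u w z nbr_in_V not_self_nbr[OF simple] by (auto simp: big_def)
  obtain f g where "minimal_star V E k v {u, w, z} f g"
    by (rule minimal_starE[of "{u, w, z}" v]) (use u(1) w(1) z(1) star_vertices not_self_nbr[OF simple] in \<open>auto simp: nbrs_def\<close>)
  then interpret minimal_star V E k v "{u, w, z}" f g .
  have card_T: "card {u, w, z} = 3" using star_vertices z by simp
  have remove: "card P - 1 \<le> card (P - {f v})" for P using diff_card_le_card_Diff[of "{f v}" P] by simp
  have "big_nbrs E v - {u, w, z} = big_nbrs E v - {u}" using w z by (auto simp: big_nbrs_def)
  then have "card (big_nbrs E v - {u, w, z}) \<le> 4"
    using degree_eq_big_plus_small[OF simple, of v] degree_v u by (simp add: big_nbrs_def)
  then have sums: "card (sums_nearby u) \<le> 3" "card (sums_nearby v) \<le> 4"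
    using card_sums_nearby_leaf[of u] card_centre_bounds(2) u(2) by auto
  have "5 \<le> card (edge_colours w - {f v})"
    using card_edge_colours[of w] remove[of "edge_colours w"] w(2) degree_v(1) k_ge_11 unfolding card_T by simp
  moreover have "4 \<le> card (edge_colours z - {f v})"
    using card_edge_colours[of z] remove[of "edge_colours z"] z(2) degree_v(1) k_ge_11 unfolding card_T by simp
  moreover have "3 \<le> card (edge_colours u - {f v})"
    using card_edge_colours[of u] remove[of "edge_colours u"] u(2) degree_v(1) k_ge_11 unfolding card_T by simp
  moreover have "4 \<le> card (vertex_colours u - {f v})"
    using card_vertex_colours_leaf[of u] remove[of "vertex_colours u"] u(2) k_ge_11 by simp
  ultimately obtain b b' a c where "b \<in> edge_colours w - {f v}" "b' \<in> edge_colours z - {f v}"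
    "a \<in> edge_colours u - {f v}" "c \<in> vertex_colours u - {f v}"
    "b \<noteq> b'" "b \<noteq> a" "b' \<noteq> a" "a \<noteq> c" "rest_sum u + a + c \<notin> sums_nearby u"
    "rest_sum v + f v + b + b' + a \<notin> sums_nearby v" "rest_sum v + f v + b + b' \<noteq> rest_sum u + c"
    by (rule choose_two_small_edges_edge_and_end[OF _ _ _ _ finite_lists(3) sums(1) finite_lists(3) sums(2)])
  then have "star_solved ((\<lambda>_. f v)(u := c)) ((\<lambda>_. b)(u := a, z := b'))"
    using star_vertices z(3) old_centre_colour by (simp add: star_solution_def add_ac)
  then show False using no_star_solution by blast
qed

lemma no_nbrs_of_degree_4_if_degree_8:
  assumes degree_v: "degree E v = 8" "card (small_nbrs E v) = 6"
  shows "nbrs_of_degree E v 4 = {}"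
proof (rule ccontr)
  let ?S = "small_nbrs E v"
  assume "nbrs_of_degree E v 4 \<noteq> {}"
  then obtain u where u: "u \<in> nbrs E v" "degree E u = 4" by (auto simp: nbrs_of_degree_def)
  have small: "finite ?S" "u \<notin> ?S" "v \<notin> ?S" "\<And>w. w \<in> ?S \<Longrightarrow> degree E w \<le> 3" "?S \<inter> big V E = {}"
    using u finite_nbr_classes(2)[OF simple] not_self_nbr[OF simple] by (auto simp: small_nbrs_def big_def)
  obtain w where w: "w \<in> ?S" using degree_v(2) by fastforce
  have star_vertices: "u \<noteq> v" "u \<in> big V E" using u nbr_in_V not_self_nbr[OF simple] by (auto simp: big_def)
  obtain f g where "minimal_star V E k v (insert u ?S) f g"
    by (rule minimal_starE[of "insert u ?S" v])
      (use u(1) small(5) not_self_nbr[OF simple] in \<open>auto simp: nbrs_def small_nbrs_def\<close>)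
  then interpret minimal_star V E k v "insert u ?S" f g .
  have card_T: "card (insert u ?S) = 7" using small degree_v(2) by simp
  have "big_nbrs E v - insert u ?S = big_nbrs E v - {u}" by (auto simp: big_nbrs_def small_nbrs_def)
  then have "card (big_nbrs E v - insert u ?S) = 1"
    using degree_eq_big_plus_small[OF simple, of v] degree_v u by (simp add: big_nbrs_def)
  then have sizes: "card ?S + 2 < card (vertex_colours v)" "7 \<le> card (edge_colours u)"
    "5 \<le> card (vertex_colours u)" "card (sums_nearby v) \<le> 1"
    using card_edge_colours[of u] card_vertex_colours_leaf[of u] card_centre_bounds u(2) degree_v k_ge_11
    unfolding card_T by auto
  have small_edges: "card ?S + 2 \<le> card (edge_colours w)" if "w \<in> ?S" for w
    using card_edge_colours[of w] small(4)[OF that] that degree_v k_ge_11 unfolding card_T by auto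
  obtain y where y: "y \<in> vertex_colours v" "surplus ?S (\<lambda>w. edge_colours w - {y}) 2"
    by (rule surplus_remove_choice[OF small(1) w small_edges finite_lists(1) sizes(1)])
  obtain a c where a: "a \<in> edge_colours u - {y}" and c: "c \<in> vertex_colours u - {a, y}"
    "c + rest_sum u + a \<notin> sums_nearby u"
    by (rule leaf_coloursE[of u y]) (use sizes(2,3) u(2) in simp_all)
  let ?W = "insert (c + rest_sum u + a) (sums_nearby v)"
  have W: "finite ?W" "card ?W \<le> card ?S * 1"
    using sizes(4) degree_v(2) finite_lists(3)[of v] by (simp_all add: card_insert_if)
  have finite: "finite (edge_colours w - {y})" for w by (intro finite_Diff finite_lists)
  have surplus: "surplus ?S (\<lambda>w. edge_colours w - {y}) (Suc 1)" using y(2) by (simp add: numeral_2_eq_2)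
  obtain x where x: "sdr (insert u ?S) (\<lambda>w. edge_colours w - {y}) x" "x u = a"
    "y + rest_sum v + sum x (insert u ?S) \<notin> ?W"
    by (rule sdr_insert_avoiding_sums[OF small(1,2) finite surplus a W])
  have "insert u ?S \<inter> insert v (big V E) = {u}" using star_vertices small(3,5) by auto
  then have "star_solved ((\<lambda>_. y)(u := c)) x"
    using x y(1) c by (intro star_solution_one_coloured_leaf) simp_all
  then show False using no_star_solution by blast
qed

section \<open>Discharging\<close>

lemma card_nbrs_of_degree_4_le: "card (nbrs_of_degree E v 4) \<le> card (big_nbrs E v)"
  using finite_nbr_classes(1)[OF simple] by (intro card_mono) (auto simp: nbrs_of_degree_def big_nbrs_def)

lemma card_small_nbrs_pos: "small_nbrs E v \<noteq> {} \<Longrightarrow> 1 \<le> card (small_nbrs E v)"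
  using finite_nbr_classes(2)[OF simple] by (simp add: Suc_le_eq card_gt_0_iff)

lemma charge_if_nbr_of_degree_le_2:
  assumes low: "\<exists>u\<in>nbrs E v. degree E u \<le> 2"
  shows "84 + 3 * card (nbrs_of_degree E v 4) \<le> 18 * card (big_nbrs E v)"
proof -
  obtain w where w: "w \<in> nbrs E v" "degree E w \<le> 2" using low by blast
  have small: "w \<in> small_nbrs E v" "small_nbrs E v \<noteq> {}" using w by (auto simp: small_nbrs_def)
  note degree_split = degree_eq_big_plus_small[OF simple, of v]
  have spare: "spare v = k - (degree E v + 3) + 1" using low by (simp add: spare_def)
  then have few_small: "card (small_nbrs E v) + 2 \<le> card (big_nbrs E v)"
    by (intro n_small_add_2_le[OF small(2)]) simp
  have card_degree_4_le: "card (nbrs_of_degree E v 4) \<le> card (big_nbrs E v)" by (rule card_nbrs_of_degree_4_le)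
  consider "degree E v = 6" | "degree E v = 7" | "degree E v = 8" | "9 \<le> degree E v"
    using degree_ge_6_if_small_nbr[OF small(2)] by linarith
  then show ?thesis
  proof cases
    case 1
    have "card (small_nbrs E v) * 3 < card (big_nbrs E v)"
      using 1 spare k_ge_11 by (intro n_small_mult_less[OF small(2)]) simp
    then have "5 \<le> card (big_nbrs E v)" using 1 degree_split by linarith
    then show ?thesis using no_nbrs_of_degree_4_if_degree_6[OF 1 small(1)] by simp
  next
    case 2
    have "card (small_nbrs E v) * 2 < card (big_nbrs E v)"
      using 2 spare k_ge_11 by (intro n_small_mult_less[OF small(2)]) simp
    then consider "card (small_nbrs E v) = 2" "card (big_nbrs E v) = 5" | "6 \<le> card (big_nbrs E v)"
      using 2 degree_split by linarith
    then show ?thesis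
      using no_nbrs_of_degree_4_if_degree_7[OF 2 _ w] card_degree_4_le by cases auto
  next
    case 3
    then consider "card (small_nbrs E v) = 3" "card (big_nbrs E v) = 5" | "6 \<le> card (big_nbrs E v)"
      using few_small degree_split by linarith
    then show ?thesis using card_nbrs_of_degree_4_le_2[OF 3 _ low] card_degree_4_le by cases auto
  next
    case 4
    then have "6 \<le> card (big_nbrs E v)" using few_small degree_split by linarith
    then show ?thesis using card_degree_4_le by linarith
  qed
qed

lemma charge_counting_small_nbrs:
  assumes degree_v: "5 \<le> degree E v"
  shows "84 + 3 * card (nbrs_of_degree E v 4) \<le> 8 * card (small_nbrs E v) + 18 * card (big_nbrs E v)"
proof -
  note degree_split = degree_eq_big_plus_small[OF simple, of v]
  have card_degree_4_le: "card (nbrs_of_degree E v 4) \<le> card (big_nbrs E v)" by (rule card_nbrs_of_degree_4_le)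
  show ?thesis
  proof (cases "small_nbrs E v = {}")
    case True
    then show ?thesis using card_nbrs_of_degree_4_le_1[of v] degree_split degree_v card_degree_4_le by (cases "degree E v = 5") auto
  next
    case False
    then have small_pos: "1 \<le> card (small_nbrs E v)" by (rule card_small_nbrs_pos)
    have big_ge_2: "2 \<le> card (big_nbrs E v)" using False by (rule n_big_ge_2)
    consider "degree E v = 6" | "degree E v = 7" | "degree E v = 8" | "9 \<le> degree E v"
      using degree_ge_6_if_small_nbr[OF False] by linarith
    then show ?thesis
    proof cases
      case 1
      have "card (small_nbrs E v) * 2 < card (big_nbrs E v)"
        using 1 k_ge_11 by (intro n_small_mult_less[OF False]) (simp add: spare_def)
      then have "5 \<le> card (big_nbrs E v)" using 1 degree_split by linarith
      moreover have "nbrs_of_degree E v 4 = {}" using no_nbrs_of_degree_4_if_degree_6[OF 1] False by blast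
      ultimately show ?thesis by simp
    next
      case 2
      have "card (small_nbrs E v) + 2 \<le> card (big_nbrs E v)"
        using 2 k_ge_11 by (intro n_small_add_2_le[OF False]) (simp add: spare_def)
      then show ?thesis using 2 degree_split small_pos card_degree_4_le by linarith
    next
      case 3
      then consider "card (small_nbrs E v) = 6" | "3 \<le> card (big_nbrs E v)" using big_ge_2 degree_split by linarith
      then show ?thesis using no_nbrs_of_degree_4_if_degree_8[OF 3] degree_split 3 card_degree_4_le by cases auto
    next
      case 4
      then show ?thesis using big_ge_2 degree_split card_degree_4_le by linarith
    qed
  qed
qed

definition core :: "'a set" where
  "core = {v \<in> V. 3 \<le> degree E v}"

lemma nbrs_in_core: "nbrs E v \<inter> core = nbrs_of_degree E v 3 \<union> big_nbrs E v"
  using nbr_in_V by (auto simp: core_def nbrs_of_degree_def big_nbrs_def)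

definition demand :: "'a \<Rightarrow> real" where
  "demand v = (if degree E v = 3 then 5/9 else if degree E v = 4 then 1/6 else 0)"

lemma sum_nbrs_demand:
  "(\<Sum>u\<in>nbrs E v \<inter> core. 1 - demand u) =
    4/9 * card (nbrs_of_degree E v 3) + card (big_nbrs E v) - 1/6 * card (nbrs_of_degree E v 4)"
proof -
  have "(\<Sum>u\<in>nbrs_of_degree E v 3. 1 - demand u) = 4/9 * card (nbrs_of_degree E v 3)"
    by (simp add: demand_def nbrs_of_degree_def)
  moreover have "(\<Sum>u\<in>big_nbrs E v. demand u) = (\<Sum>u\<in>{u \<in> big_nbrs E v. degree E u = 4}. 1/6)"
    using finite_nbr_classes(1)[OF simple] by (subst sum.inter_filter) (auto simp: demand_def big_nbrs_def intro!: sum.cong)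
  moreover have "{u \<in> big_nbrs E v. degree E u = 4} = nbrs_of_degree E v 4"
    by (auto simp: big_nbrs_def nbrs_of_degree_def)
  moreover have "nbrs_of_degree E v 3 \<inter> big_nbrs E v = {}" by (auto simp: big_nbrs_def nbrs_of_degree_def)
  ultimately show ?thesis
    unfolding nbrs_in_core using finite_nbr_classes[OF simple]
    by (subst sum.union_disjoint) (simp_all add: sum_subtractf)
qed

lemma final_charge_if_degree_ge_5:
  assumes degree_v: "5 \<le> degree E v"
  shows "14/3 \<le> (\<Sum>u\<in>nbrs E v \<inter> core. 1 - demand u)"
proof -
  have "84 + 3 * card (nbrs_of_degree E v 4) \<le> 8 * card (nbrs_of_degree E v 3) + 18 * card (big_nbrs E v)"
  proof (cases "\<exists>u\<in>nbrs E v. degree E u \<le> 2")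
    case True
    then show ?thesis using charge_if_nbr_of_degree_le_2 by fastforce
  next
    case False
    then have "small_nbrs E v = nbrs_of_degree E v 3" by (force simp: small_nbrs_def nbrs_of_degree_def)
    then show ?thesis using charge_counting_small_nbrs[OF degree_v] by simp
  qed
  then show ?thesis unfolding sum_nbrs_demand by simp
qed

lemma final_charge_if_nbrs_large:
  assumes "\<And>u. u \<in> nbrs E v \<Longrightarrow> 5 \<le> degree E u"
  shows "(\<Sum>u\<in>nbrs E v \<inter> core. 1 + demand v - demand u) = degree E v * (1 + demand v)"
proof -
  have "nbrs E v \<inter> core = nbrs E v" using assms nbr_in_V by (fastforce simp: core_def)
  moreover have "demand u = 0" if "u \<in> nbrs E v" for u using assms[OF that] by (simp add: demand_def)
  ultimately show ?thesis by (simp add: degree_eq_card_nbrs[OF simple])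
qed

lemma final_charge:
  assumes v: "v \<in> core"
  shows "14/3 \<le> (\<Sum>u\<in>nbrs E v \<inter> core. 1 + demand v - demand u)"
proof -
  consider "degree E v = 3" | "degree E v = 4" | "5 \<le> degree E v" using v unfolding core_def by fastforce
  then show ?thesis
  proof cases
    case 1
    have "5 \<le> degree E u" if "u \<in> nbrs E v" for u
    proof -
      have "v \<in> small_nbrs E u" using that 1 nbrs_sym[of u E v] by (simp add: small_nbrs_def)
      then show ?thesis using degree_ge_6_if_small_nbr[of u] by fastforce
    qed
    then show ?thesis using 1 by (subst final_charge_if_nbrs_large) (simp_all add: demand_def)
  next
    case 2
    have "5 \<le> degree E u" if "u \<in> nbrs E v" for u
      using degree_ge_5_if_nbr_of_degree_4[of v u] that 2 nbrs_sym[of u E v] by simp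
    then show ?thesis using 2 by (subst final_charge_if_nbrs_large) (simp_all add: demand_def)
  next
    case 3
    then show ?thesis using final_charge_if_degree_ge_5 by (simp add: demand_def)
  qed
qed

lemma core_nonempty: "core \<noteq> {}"
proof
  assume "core = {}"
  then have small: "degree E w \<le> 2" if "w \<in> V" for w using that unfolding core_def by force
  have "E = {}"
  proof (rule equals0I)
    fix e assume e: "e \<in> E"
    then obtain u v where "e = {v, u}" using simple by (auto simp: simple_graph_def card_2_iff)
    then have u: "u \<in> nbrs E v" using e by (simp add: nbrs_def)
    then have "u \<in> small_nbrs E v" using small nbr_in_V by (force simp: small_nbrs_def)
    then have "6 \<le> degree E v" using degree_ge_6_if_small_nbr by blast
    then show False using small[of v] nbr_in_V[OF u] by auto
  qed
  then have "tnsd_colouring V E k (\<lambda>_. 1) (\<lambda>_. 1)"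
    using k_ge_11 unfolding tnsd_colouring_def proper_total_colouring_def by simp
  then show False using uncolourable by blast
qed

lemma card_core_le: "14/3 * card core \<le> 2 * real (card {e \<in> E. e \<subseteq> core})"
proof -
  let ?E = "{e \<in> E. e \<subseteq> core}" and ?N = "\<lambda>v. nbrs E v \<inter> core"
  have fin: "finite core" "finite ?E" using simple_graph_finite[OF simple] by (simp_all add: core_def)
  have graph: "simple_graph core ?E" using simple fin(1) unfolding simple_graph_def by auto
  have "(\<Sum>v\<in>core. card {e \<in> ?E. v \<in> e}) = 2 * card ?E"
  proof (rule sum_multicount[OF fin], rule ballI)
    fix e assume e: "e \<in> ?E"
    then have "{v \<in> core. v \<in> e} = e" by auto
    then show "card {v \<in> core. v \<in> e} = 2" using e simple unfolding simple_graph_def by auto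
  qed
  moreover have "card {e \<in> ?E. v \<in> e} = card (?N v)" if "v \<in> core" for v
  proof -
    have "nbrs ?E v = ?N v" using that by (auto simp: nbrs_def)
    then show ?thesis using degree_eq_card_nbrs[OF graph, of v] by (simp add: degree_def incident_edges_def)
  qed
  ultimately have handshake: "(\<Sum>v\<in>core. card (?N v)) = 2 * card ?E" by simp
  have "?N v = {u \<in> core. {v, u} \<in> E}" "?N v = {u \<in> core. {u, v} \<in> E}" for v
    by (auto simp: nbrs_def insert_commute)
  then have swap: "(\<Sum>v\<in>core. \<Sum>u\<in>?N v. demand u) = (\<Sum>v\<in>core. \<Sum>u\<in>?N v. demand v)"
    using sum.swap_restrict[OF fin(1) fin(1), of "\<lambda>v u. demand u" "\<lambda>v u. {v, u} \<in> E"] by simp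
  have "14/3 * card core = (\<Sum>v\<in>core. 14/3)" by simp
  also have "\<dots> \<le> (\<Sum>v\<in>core. \<Sum>u\<in>?N v. 1 + demand v - demand u)" by (intro sum_mono final_charge)
  also have "\<dots> = (\<Sum>v\<in>core. card (?N v))"
    using swap by (simp add: sum.distrib sum_subtractf algebra_simps)
  finally show ?thesis using handshake by simp
qed

end

lemma finite_average_degrees:
  assumes "simple_graph V E"
  shows "finite {2 * real (card E') / real (card V') | V' E'.
    V' \<subseteq> V \<and> V' \<noteq> {} \<and> E' \<subseteq> E \<and> (\<forall>e\<in>E'. e \<subseteq> V')}"
proof (rule finite_subset)
  show "finite ((\<lambda>(V', E'). 2 * real (card E') / real (card V')) ` (Pow V \<times> Pow E))"
    using simple_graph_finite[OF assms] by simp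
qed auto

lemma average_degree_le_mad:
  assumes "simple_graph V E" "V' \<subseteq> V" "V' \<noteq> {}"
  shows "2 * real (card {e \<in> E. e \<subseteq> V'}) / real (card V') \<le> mad V E"
  unfolding mad_def using assms finite_average_degrees[OF assms(1)] by (intro Max_ge) auto

lemma mad_mono:
  assumes "simple_graph V E" "E' \<subseteq> E"
  shows "mad V E' \<le> mad V E"
  unfolding mad_def using assms finite_average_degrees[OF assms(1)] by (intro Max_mono) blast+

lemma (in minimal_counterexample) mad_ge: "14/3 \<le> mad V E"
proof -
  have "core \<subseteq> V" by (auto simp: core_def)
  then have "2 * real (card {e \<in> E. e \<subseteq> core}) / real (card core) \<le> mad V E"
    using core_nonempty by (rule average_degree_le_mad[OF simple])
  moreover have "0 < card core"
    using \<open>core \<subseteq> V\<close> core_nonempty simple_graph_finite(1)[OF simple] by (simp add: card_gt_0_iff finite_subset)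
  then have "14/3 \<le> 2 * real (card {e \<in> E. e \<subseteq> core}) / real (card core)"
    using card_core_le by (simp add: field_simps)
  ultimately show ?thesis by linarith
qed

lemma degree_mono: "simple_graph V E \<Longrightarrow> E' \<subseteq> E \<Longrightarrow> degree E' v \<le> degree E v"
  unfolding degree_def using simple_graph_finite(3)[of V E v] by (intro card_mono) (auto simp: incident_edges_def)

theorem tnsd_colouring_if_mad_less:
  assumes "simple_graph V E" "11 \<le> k" "\<And>v. v \<in> V \<Longrightarrow> degree E v + 3 \<le> k" "mad V E < 14/3"
  shows "\<exists>f g. tnsd_colouring V E k f g"
proof -
  have "finite E" using simple_graph_finite(2)[OF assms(1)] .
  then show ?thesis using assms
  proof (induction E rule: finite_psubset_induct)
    case (psubset E)
    have smaller: "\<exists>f g. tnsd_colouring V E' k f g" if "E' \<subset> E" for E'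
    proof (rule psubset.IH[OF that])
      show "simple_graph V E'" "mad V E' < 14/3"
        using simple_graph_subset[OF psubset.prems(1)] mad_mono[OF psubset.prems(1), of E'] psubset.prems(4) that
        by auto
      show "degree E' v + 3 \<le> k" if "v \<in> V" for v
        using degree_mono[OF psubset.prems(1), of E' v] psubset.prems(3)[OF that] \<open>E' \<subset> E\<close> by auto
    qed (rule psubset.prems)
    show ?case
    proof (rule ccontr)
      assume "\<not> ?case"
      then interpret minimal_counterexample V E k
        using psubset.prems(1-3) smaller by unfold_locales
      show False using mad_ge psubset.prems(4) by simp
    qed
  qed
qed

theorem theorem5:
  fixes V :: "'a set" and E :: "'a set set"
  assumes "simple_graph V E"
    and "max_degree V E \<ge> 8"
    and "mad V E < 14 / 3"
  shows "tnsd_index V E \<le> max_degree V E + 3"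
proof -
  have "\<exists>f g. tnsd_colouring V E (max_degree V E + 3) f g"
  proof (rule tnsd_colouring_if_mad_less[OF assms(1)])
    show "degree E v + 3 \<le> max_degree V E + 3" if "v \<in> V" for v
      using that simple_graph_finite(1)[OF assms(1)] by (simp add: max_degree_def)
  qed (use assms in auto)
  then show ?thesis unfolding tnsd_index_def by (rule Least_le)
qed

end
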